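(* Let $N\in\mathbb{N}\setminus\{0\}$ be fixed, and for each integer $E\geq N$ let $Q^{(E)}\in\mathbb{P}_N^{z_0}(\mathbb{C})$ be the fast LS-Padé denominator of $\mathcal{S}$ computed with $E$ derivatives of $\mathcal{S}$ at $z_0$, i.e. a global minimizer of $\widetilde{j}_E$ over $\mathbb{P}_N^{z_0}(\mathbb{C})$. Denote the roots of $Q^{(E)}$ by $\{\widetilde{\lambda}_\beta^{(E)}\}_{\beta=1}^N$. Then, for each $\alpha=1,\ldots,N$, there is a constant $c'_\alpha$ independent of $E$ such that $$\min_{\beta=1,\ldots,N}\left|\widetilde{\lambda}_\beta^{(E)}-\lambda_\alpha\right|\leq c'_\alpha\left|\frac{\lambda_\alpha-z_0}{\lambda_{N+1}-z_0}\right|^{2E}\quad\text{for all }E\text{ large enough.}$$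
   Context: Setting. $(V,\langle\cdot,\cdot\rangle_V)$ is a separable Hilbert space over $\mathbb{C}$ with induced norm $\|\cdot\|_V$. $\mathcal{L}:D(\mathcal{L})\subset V\to V$ is a bijective linear operator with dense domain $D(\mathcal{L})$, whose inverse $\mathcal{L}^{-1}:V\to V$ is compact and normal. $\Sigma(\mathcal{L})=\{\lambda\in\mathbb{C}:\exists v\in D(\mathcal{L})\setminus\{0\},\ \mathcal{L}v=\lambda v\}$ is its spectrum, and for $\lambda\in\Sigma(\mathcal{L})$, $P_\lambda$ is the $V$-orthogonal projection onto the eigenspace $\{v\in D(\mathcal{L}):\mathcal{L}v=\lambda v\}$. Fix $v^\star\in V$. For $z\in\mathbb{C}\setminus\Sigma(\mathcal{L})$, $\mathcal{S}(z)\in D(\mathcal{L})$ is the unique solution of $(\mathcal{L}-z\mathcal{I})\mathcal{S}(z)=v^\star$, where $\mathcal{I}$ is the identity; $\mathcal{S}$ is a meromorphic $V$-valued map and $\mathcal{S}(z)=\sum_{\lambda\in\Sigma(\mathcal{L})}\frac{P_\lambda v^\star}{\lambda-z}$. Standing assumptions. $z_0\in\mathbb{C}\setminus\Sigma(\mathcal{L})$ is fixed; $\Sigma(\mathcal{L})$ is infinite; $P_\lambda v^\star\neq0$ for all $\lambda\in\Sigma(\mathcal{L})$. The (distinct) elements of $\Sigma(\mathcal{L})$ are enumerated as $\{\lambda_\alpha\}_{\alpha=1}^\infty$ with $|\lambda_\alpha-z_0|\leq|\lambda_{\alpha+1}-z_0|$ for all $\alpha\ge1$. Notation. For a function $F$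 analytic near $z_0$ (scalar- or $V$-valued), $(F)_{\alpha,z_0}=\frac{1}{\alpha!}\frac{d^\alpha F}{dz^\alpha}(z_0)$ is its $\alpha$-th Taylor coefficient at $z_0$. $\mathbb{P}_N^{z_0}(\mathbb{C})$ is the set of polynomials $Q(z)=\sum_{j=0}^Nq_j(z-z_0)^j$ with $q_j\in\mathbb{C}$ and $\sum_{j=0}^N|q_j|^2=1$. The functional $\widetilde{j}_E:\mathbb{P}_N^{z_0}(\mathbb{C})\to[0,\infty)$ is $\widetilde{j}_E(Q)=\|(Q\mathcal{S})_{E,z_0}\|_V$. Roots of polynomials are listed with multiplicity.
   Formalization: The formal theorem additionally assumes the strict gap |λ_N − z0| < |λ_{N+1} − z0|; when these distances are equal the claim can fail (e.g. N=1, spectrum {±k}, z0=0, where the only root of the denominator can tend to infinity). *)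

theory Defs
  imports "HOL-Analysis.Analysis" "HOL-Computational_Algebra.Computational_Algebra"
begin

text \<open>Complex Hilbert spaces, on top of the real normed structure of the library. The inner
  product is linear in its first argument; real scaling, norm and topology are the induced ones.\<close>

class complex_hilbert_space = real_normed_vector + complete_space +
  fixes scaleC :: "complex \<Rightarrow> 'a \<Rightarrow> 'a" (infixr "*\<^sub>C" 75)
    and cinner :: "'a \<Rightarrow> 'a \<Rightarrow> complex"
  assumes scaleC_add_right: "a *\<^sub>C (x + y) = a *\<^sub>C x + a *\<^sub>C y"
    and scaleC_add_left: "(a + b) *\<^sub>C x = a *\<^sub>C x + b *\<^sub>C x"
    and scaleC_scaleC: "a *\<^sub>C (b *\<^sub>C x) = (a * b) *\<^sub>C x"
    and scaleC_one: "1 *\<^sub>C x = x"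
    and scaleR_scaleC: "r *\<^sub>R x = complex_of_real r *\<^sub>C x"
    and cinner_commute: "cinner x y = cnj (cinner y x)"
    and cinner_add_left: "cinner (x + y) z = cinner x z + cinner y z"
    and cinner_scaleC_left: "cinner (a *\<^sub>C x) y = a * cinner x y"
    and norm_eq_sqrt_cinner: "norm x = sqrt (Re (cinner x x))"

instantiation complex :: complex_hilbert_space
begin

definition scaleC_complex :: "complex \<Rightarrow> complex \<Rightarrow> complex"
  where "scaleC_complex a x = a * x"

definition cinner_complex :: "complex \<Rightarrow> complex \<Rightarrow> complex"
  where "cinner_complex x y = x * cnj y"

instance
  by standard
    (auto simp: scaleC_complex_def cinner_complex_def algebra_simps scaleR_conv_of_real
      cmod_def power2_eq_square)

end

text \<open>An operator with domain \<open>D\<close> is a total function whose values outside \<open>D\<close> are never used.\<close>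

definition linear_operator :: "'v::complex_hilbert_space set \<Rightarrow> ('v \<Rightarrow> 'v) \<Rightarrow> bool"
  where "linear_operator D L \<longleftrightarrow>
    0 \<in> D \<and> (\<forall>x\<in>D. \<forall>y\<in>D. x + y \<in> D \<and> L (x + y) = L x + L y) \<and>
    (\<forall>x\<in>D. \<forall>a. a *\<^sub>C x \<in> D \<and> L (a *\<^sub>C x) = a *\<^sub>C L x)"

definition compact_operator :: "('v::complex_hilbert_space \<Rightarrow> 'v) \<Rightarrow> bool"
  where "compact_operator T \<longleftrightarrow>
    linear_operator UNIV T \<and> (\<forall>B. bounded B \<longrightarrow> compact (closure (T ` B)))"

definition is_adjoint :: "('v::complex_hilbert_space \<Rightarrow> 'v) \<Rightarrow> ('v \<Rightarrow> 'v) \<Rightarrow> bool"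
  where "is_adjoint T T' \<longleftrightarrow> (\<forall>x y. cinner (T x) y = cinner x (T' y))"

definition normal_operator :: "('v::complex_hilbert_space \<Rightarrow> 'v) \<Rightarrow> bool"
  where "normal_operator T \<longleftrightarrow> (\<exists>T'. is_adjoint T T' \<and> T \<circ> T' = T' \<circ> T)"

definition eigenspace :: "'v::complex_hilbert_space set \<Rightarrow> ('v \<Rightarrow> 'v) \<Rightarrow> complex \<Rightarrow> 'v set"
  where "eigenspace D L l = {v \<in> D. L v = l *\<^sub>C v}"

definition spectrum :: "'v::complex_hilbert_space set \<Rightarrow> ('v \<Rightarrow> 'v) \<Rightarrow> complex set"
  where "spectrum D L = {l. \<exists>v \<in> D - {0}. L v = l *\<^sub>C v}"

definition orth_proj :: "'v::complex_hilbert_space set \<Rightarrow> 'v \<Rightarrow> 'v"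
  where "orth_proj M x = (THE y. y \<in> M \<and> (\<forall>w\<in>M. cinner (x - y) w = 0))"

definition solution :: "'v::complex_hilbert_space set \<Rightarrow> ('v \<Rightarrow> 'v) \<Rightarrow> 'v \<Rightarrow> complex \<Rightarrow> 'v"
  where "solution D L v z = (THE u. u \<in> D \<and> L u - z *\<^sub>C u = v)"


definition vderiv :: "(complex \<Rightarrow> 'v::complex_hilbert_space) \<Rightarrow> complex \<Rightarrow> 'v"
  where "vderiv F z = Lim (at 0) (\<lambda>h. inverse h *\<^sub>C (F (z + h) - F z))"

definition taylor_coeff :: "(complex \<Rightarrow> 'v::complex_hilbert_space) \<Rightarrow> nat \<Rightarrow> complex \<Rightarrow> 'v"
  where "taylor_coeff F n z0 = inverse (fact n) *\<^sub>C (vderiv ^^ n) F z0"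


definition normalized_polys :: "nat \<Rightarrow> complex \<Rightarrow> complex poly set"
  where "normalized_polys N z0 =
    {Q. \<exists>q :: nat \<Rightarrow> complex. Q = (\<Sum>j\<le>N. smult (q j) ([:- z0, 1:] ^ j)) \<and>
                          (\<Sum>j\<le>N. (cmod (q j))\<^sup>2) = 1}"

definition pade_functional ::
    "(complex \<Rightarrow> 'v::complex_hilbert_space) \<Rightarrow> complex \<Rightarrow> nat \<Rightarrow> complex poly \<Rightarrow> real"
  where "pade_functional S z0 E Q = norm (taylor_coeff (\<lambda>z. poly Q z *\<^sub>C S z) E z0)"

definition is_fast_pade_denominator ::
    "(complex \<Rightarrow> 'v::complex_hilbert_space) \<Rightarrow> complex \<Rightarrow> nat \<Rightarrow> nat \<Rightarrow> complex poly \<Rightarrow> bool"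
  where "is_fast_pade_denominator S z0 N E Q \<longleftrightarrow>
    is_arg_min (pade_functional S z0 E) (\<lambda>R. R \<in> normalized_polys N z0) Q"

end

theory Submission
  imports Defs "HOL-Complex_Analysis.Cauchy_Integral_Formula"
begin

text \<open>The inverse of the operator is compact and normal, so the eigenspaces are orthogonal and complete.
  With \<open>v\<^sub>k\<close> the projection of the right-hand side onto the eigenspace of \<open>\<mu>\<^sub>k\<close> and
  \<open>\<delta>\<^sub>k = \<mu>\<^sub>k - z\<^sub>0\<close>, the solution map is \<open>S(z) = \<Sum>\<^sub>k v\<^sub>k / (\<mu>\<^sub>k - z)\<close>. For a polynomial \<open>P\<close> of degree at
  most \<open>E\<close>, the \<open>E\<close>-th Taylor coefficient of \<open>P S\<close> is therefore
  \<open>\<tau>(P) = \<Sum>\<^sub>k (P(\<mu>\<^sub>k) / \<delta>\<^sub>k\<^sup>E\<^sup>+\<^sup>1) v\<^sub>k\<close>, an orthogonal series.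

  Number the poles from 0, and let \<open>\<rho> = \<bar>\<delta>\<^sub>N\<bar>\<close>. The normalised polynomial with roots
  \<open>\<mu>\<^sub>0, \<dots>, \<mu>\<^sub>N\<^sub>-\<^sub>1\<close> shows that the minimum of \<open>\<parallel>\<tau>\<parallel>\<close> is \<open>O(\<rho>\<^sup>-\<^sup>E)\<close>. A minimizer \<open>Q\<close> is an eigenvector of the Gram
  form \<open>\<langle>\<tau>(P), \<tau>(R)\<rangle>\<close> with respect to the inner product of coefficients, and the eigenvalue is the
  squared minimum. Pairing \<open>\<tau>(Q)\<close> with \<open>\<tau>(R)\<close>, where \<open>R\<close> has all of \<open>\<mu>\<^sub>0, \<dots>, \<mu>\<^sub>N\<^sub>-\<^sub>1\<close> except \<open>\<mu>\<^sub>a\<close> as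
  roots, gives \<open>Q(\<mu>\<^sub>a) = O(\<bar>\<delta>\<^sub>a / \<rho>\<bar>\<^sup>2\<^sup>E)\<close>: the factor 2 in the exponent comes from this second-order
  information on the minimizer (\<open>minimizer_stationary\<close>, \<open>minimizer_at_pole\<close>).

  These values tend to zero, so by Lagrange interpolation \<open>Q\<close> is close to a multiple of the
  polynomial with roots \<open>\<mu>\<^sub>0, \<dots>, \<mu>\<^sub>N\<^sub>-\<^sub>1\<close>. Normalisation keeps the factor away from zero, and with it the derivative
  of \<open>Q\<close> at \<open>\<mu>\<^sub>a\<close>. Since \<open>Q' / Q\<close> is the sum of \<open>1 / (z - r)\<close> over the \<open>N\<close> roots, some root lies within
  \<open>N \<bar>Q(\<mu>\<^sub>a) / Q'(\<mu>\<^sub>a)\<bar>\<close> of \<open>\<mu>\<^sub>a\<close> (\<open>root_distance\<close>, \<open>minimizer_roots\<close>).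

  The analytic input is the spectral theorem for compact normal operators, in the form
  \<open>eigenprojections\<close>, and termwise differentiation of orthogonal series (\<open>vderiv_funpow_suminf\<close>).\<close>

section \<open>Complex Hilbert spaces\<close>

instance complex_hilbert_space \<subseteq> banach ..

lemma cinner_add_right: "cinner x (y + z) = cinner x y + cinner x z"
  for x :: "'v::complex_hilbert_space"
  by (metis cinner_add_left cinner_commute complex_cnj_add)

lemma cinner_scaleC_right: "cinner x (a *\<^sub>C y) = cnj a * cinner x y"
  for x :: "'v::complex_hilbert_space"
  by (metis cinner_commute cinner_scaleC_left complex_cnj_mult)

lemma cinner_self: "cinner x x = complex_of_real ((norm x)\<^sup>2)"
  for x :: "'v::complex_hilbert_space"
proof -
  have "Im (cinner x x) = 0"
    using cinner_commute[of x x] by (metis Reals_cnj_iff complex_is_Real_iff)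
  moreover have "0 \<le> Re (cinner x x)"
    using norm_eq_sqrt_cinner[of x] norm_ge_zero[of x] by (metis real_sqrt_ge_0_iff)
  then have "(norm x)\<^sup>2 = Re (cinner x x)"
    by (simp add: norm_eq_sqrt_cinner)
  ultimately show ?thesis
    by (simp add: complex_eq_iff)
qed

lemma norm_scaleC: "norm (a *\<^sub>C x) = cmod a * norm x"
  for x :: "'v::complex_hilbert_space"
proof -
  have "complex_of_real ((norm (a *\<^sub>C x))\<^sup>2) = a * cnj a * cinner x x"
    unfolding cinner_self[symmetric] by (simp add: cinner_scaleC_left cinner_scaleC_right)
  also have "\<dots> = complex_of_real ((cmod a * norm x)\<^sup>2)"
    by (simp add: cinner_self complex_norm_square[symmetric] power_mult_distrib)
  finally have "(norm (a *\<^sub>C x))\<^sup>2 = (cmod a * norm x)\<^sup>2"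
    using of_real_eq_iff by blast
  then show ?thesis
    by (simp add: power2_eq_iff_nonneg)
qed

lemma norm_add_square:
  "(norm (x + y))\<^sup>2 = (norm x)\<^sup>2 + 2 * Re (cinner x y) + (norm y)\<^sup>2"
  for x :: "'v::complex_hilbert_space"
proof -
  have "complex_of_real ((norm (x + y))\<^sup>2) =
      cinner x x + cinner y y + (cinner x y + cinner y x)"
    unfolding cinner_self[symmetric] by (simp add: cinner_add_left cinner_add_right)
  also have "cinner y x = cnj (cinner x y)"
    by (rule cinner_commute)
  finally show ?thesis
    by (simp add: cinner_self complex_eq_iff)
qed

lemma norm_add_scaleC_square:
  "(norm (x + t *\<^sub>C y))\<^sup>2 = (norm x)\<^sup>2 + 2 * Re (cnj t * cinner x y) + (cmod t)\<^sup>2 * (norm y)\<^sup>2"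
  for x :: "'v::complex_hilbert_space"
  by (simp add: norm_add_square cinner_scaleC_right norm_scaleC power_mult_distrib)

lemma Cauchy_Schwarz: "cmod (cinner x y) \<le> norm x * norm y"
  for x :: "'v::complex_hilbert_space"
proof (cases "y = 0")
  case True
  have "0 *\<^sub>C y = 0"
    using scaleR_scaleC[of 0 y] by simp
  then have "cinner x y = 0"
    using True cinner_scaleC_right[of x 0 y] by simp
  then show ?thesis by simp
next
  case False
  define c where "c = cinner x y"
  \<comment> \<open>The value of \<open>t\<close> that minimises the norm of \<open>x + t y\<close>.\<close>
  define t where "t = - c / complex_of_real ((norm y)\<^sup>2)"
  have n: "(norm y)\<^sup>2 > 0"
    using False by simp
  have "cnj t * c = - complex_of_real ((cmod c)\<^sup>2 / (norm y)\<^sup>2)"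
    unfolding t_def using complex_norm_square[of c] by (simp add: mult.commute)
  then have 1: "Re (cnj t * c) = - ((cmod c)\<^sup>2 / (norm y)\<^sup>2)"
    by (simp only: uminus_complex.sel Re_complex_of_real)
  have "cmod t = cmod c / (norm y)\<^sup>2"
    unfolding t_def by (simp add: norm_divide norm_power)
  then have 2: "(cmod t)\<^sup>2 * (norm y)\<^sup>2 = (cmod c)\<^sup>2 / (norm y)\<^sup>2"
    using n by (simp add: power_divide power2_eq_square)
  have "0 \<le> (norm x)\<^sup>2 - (cmod c)\<^sup>2 / (norm y)\<^sup>2"
    using norm_add_scaleC_square[of x t y] 1 2 zero_le_power2[of "norm (x + t *\<^sub>C y)"]
    unfolding c_def by linarith
  then have "(cmod c)\<^sup>2 \<le> (norm x * norm y)\<^sup>2"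
    using n by (simp add: field_simps)
  then show ?thesis
    unfolding c_def by (rule power2_le_imp_le) simp
qed

text \<open>The two interpretations make the library rules on linearity, continuity and summation available
  for the inner product and for complex scaling.\<close>

interpretation cinner: bounded_bilinear "cinner :: 'v::complex_hilbert_space \<Rightarrow> 'v \<Rightarrow> complex"
proof
  fix a a' b b' :: 'v and r :: real
  show "cinner (a + a') b = cinner a b + cinner a' b" by (rule cinner_add_left)
  show "cinner a (b + b') = cinner a b + cinner a b'" by (rule cinner_add_right)
  show "cinner (r *\<^sub>R a) b = r *\<^sub>R cinner a b"
    by (simp add: scaleR_scaleC cinner_scaleC_left scaleC_complex_def)
  show "cinner a (r *\<^sub>R b) = r *\<^sub>R cinner a b"
    by (simp add: scaleR_scaleC cinner_scaleC_right scaleC_complex_def)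
  show "\<exists>K. \<forall>a b. norm (cinner a b :: complex) \<le> norm (a :: 'v) * norm (b :: 'v) * K"
    by (intro exI[of _ 1]) (simp add: Cauchy_Schwarz)
qed

interpretation scaleC: bounded_bilinear "scaleC :: complex \<Rightarrow> 'v::complex_hilbert_space \<Rightarrow> 'v"
proof
  fix a a' :: complex and b b' :: 'v and r :: real
  show "(a + a') *\<^sub>C b = a *\<^sub>C b + a' *\<^sub>C b" by (rule scaleC_add_left)
  show "a *\<^sub>C (b + b') = a *\<^sub>C b + a *\<^sub>C b'" by (rule scaleC_add_right)
  show "(r *\<^sub>R a) *\<^sub>C b = r *\<^sub>R a *\<^sub>C b"
    by (simp add: scaleR_scaleC scaleC_scaleC scaleC_complex_def)
  show "a *\<^sub>C r *\<^sub>R b = r *\<^sub>R a *\<^sub>C b"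
    by (simp add: scaleR_scaleC scaleC_scaleC scaleC_complex_def mult.commute)
  show "\<exists>K. \<forall>a b. norm (a *\<^sub>C (b::'v)) \<le> norm a * norm b * K"
    by (intro exI[of _ 1]) (simp add: norm_scaleC)
qed

declare scaleC_one [simp] scaleC_scaleC [simp] scaleC.zero_left [simp] scaleC.zero_right [simp]

lemma scaleC_eq_0_iff [simp]: "a *\<^sub>C x = 0 \<longleftrightarrow> a = 0 \<or> x = 0"
  for x :: "'v::complex_hilbert_space"
  by (metis norm_eq_zero norm_scaleC mult_eq_0_iff)

lemma cinner_self_eq_0_iff [simp]: "cinner x x = 0 \<longleftrightarrow> x = 0"
  for x :: "'v::complex_hilbert_space"
  by (simp add: cinner_self)

lemma minus_scaleC: "- x = (- 1) *\<^sub>C x"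
  for x :: "'v::complex_hilbert_space"
  by (simp add: scaleC.minus_left)

lemma eq_if_cinner_eq:
  fixes x :: "'v::complex_hilbert_space"
  assumes "\<And>z. cinner z x = cinner z y"
  shows "x = y"
proof -
  have "cinner (x - y) (x - y) = 0"
    by (simp add: cinner.diff_right assms)
  then show ?thesis by simp
qed

text \<open>The first-order condition at a minimum of a quadratic in a complex parameter; it serves both the
  orthogonality of the projection error and the stationarity of the Pade minimizers.\<close>

lemma zero_if_quadratic_nonneg:
  assumes "\<And>t. 0 \<le> 2 * Re (cnj t * a) + (cmod t)\<^sup>2 * K"
  shows "a = 0"
proof (rule ccontr)
  assume "a \<noteq> 0"
  \<comment> \<open>For small \<open>s\<close> the linear term dominates at \<open>t = - s a\<close>.\<close>
  define s where "s = 1 / (\<bar>K\<bar> + 1)"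
  have s: "0 < s" "s * K < 1"
    unfolding s_def by (auto simp: field_simps abs_if)
  have "cnj (- complex_of_real s * a) * a = - complex_of_real (s * (cmod a)\<^sup>2)"
    using complex_norm_square[of a] by (simp add: mult.commute mult.left_commute)
  then have "Re (cnj (- complex_of_real s * a) * a) = - (s * (cmod a)\<^sup>2)"
    by (simp only: uminus_complex.sel Re_complex_of_real)
  moreover have "(cmod (- complex_of_real s * a))\<^sup>2 * K = s * (cmod a)\<^sup>2 * (s * K)"
    by (simp add: norm_mult power_mult_distrib) (simp add: power2_eq_square)
  moreover have "s * (cmod a)\<^sup>2 * (s * K) < s * (cmod a)\<^sup>2 * 1"
    using s \<open>a \<noteq> 0\<close> by (intro mult_strict_left_mono) auto
  moreover have "s * (cmod a)\<^sup>2 > 0"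
    using s \<open>a \<noteq> 0\<close> by simp
  ultimately show False
    using assms[of "- complex_of_real s * a"] by linarith
qed

section \<open>Orthogonal projections\<close>

definition closed_csubspace :: "'v::complex_hilbert_space set \<Rightarrow> bool"
  where "closed_csubspace M \<longleftrightarrow>
    closed M \<and> 0 \<in> M \<and> (\<forall>x\<in>M. \<forall>y\<in>M. x + y \<in> M) \<and> (\<forall>a. \<forall>x\<in>M. a *\<^sub>C x \<in> M)"

lemma closed_csubspaceD:
  assumes "closed_csubspace M"
  shows "closed M" "0 \<in> M" "x \<in> M \<Longrightarrow> y \<in> M \<Longrightarrow> x + y \<in> M" "x \<in> M \<Longrightarrow> a *\<^sub>C x \<in> M"
    "x \<in> M \<Longrightarrow> y \<in> M \<Longrightarrow> x - y \<in> M"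
  using assms unfolding closed_csubspace_def
  by (simp_all, metis diff_conv_add_uminus minus_scaleC)

lemma closed_csubspace_scaleR: "closed_csubspace M \<Longrightarrow> x \<in> M \<Longrightarrow> r *\<^sub>R x \<in> M"
  by (simp add: scaleR_scaleC closed_csubspaceD(4))

lemma parallelogram: "(norm (x + y))\<^sup>2 + (norm (x - y))\<^sup>2 = 2 * (norm x)\<^sup>2 + 2 * (norm y)\<^sup>2"
  for x :: "'v::complex_hilbert_space"
  using norm_add_square[of x y] norm_add_square[of x "- y"] by (simp add: cinner.minus_right)

lemma orthogonal_projection_exists:
  fixes x :: "'v::complex_hilbert_space"
  assumes M: "closed_csubspace M"
  shows "\<exists>y\<in>M. \<forall>w\<in>M. cinner (x - y) w = 0"
proof -
  \<comment> \<open>A sequence minimising the distance to \<open>x\<close> is Cauchy by the parallelogram law.\<close>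
  define d where "d = (INF y\<in>M. (norm (x - y))\<^sup>2)"
  have bdd: "bdd_below ((\<lambda>y. (norm (x - y))\<^sup>2) ` M)"
    by (rule bdd_belowI2[where m = 0]) simp
  have d_le: "d \<le> (norm (x - y))\<^sup>2" if "y \<in> M" for y
    unfolding d_def using bdd that by (rule cINF_lower)
  have "\<exists>y\<in>M. (norm (x - y))\<^sup>2 < d + inverse (real (Suc n))" for n
  proof -
    have "(INF y\<in>M. (norm (x - y))\<^sup>2) < d + inverse (real (Suc n))"
      unfolding d_def by simp
    then show ?thesis
      using bdd closed_csubspaceD(2)[OF M] by (subst (asm) cINF_less_iff) auto
  qed
  then obtain Y where Y: "\<And>n. Y n \<in> M" "\<And>n. (norm (x - Y n))\<^sup>2 < d + inverse (real (Suc n))"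
    by metis
  have close: "(norm (Y n - Y m))\<^sup>2 \<le> 2 * inverse (real (Suc n)) + 2 * inverse (real (Suc m))" for n m
  proof -
    define h where "h = (1/2::real) *\<^sub>R (Y n + Y m)"
    have "h \<in> M"
      unfolding h_def using M Y by (intro closed_csubspace_scaleR closed_csubspaceD(3))
    have "(x - Y n) + (x - Y m) = 2 *\<^sub>R (x - h)"
      unfolding h_def by (simp add: algebra_simps scaleR_2)
    then have "(norm ((x - Y n) + (x - Y m)))\<^sup>2 = 4 * (norm (x - h))\<^sup>2"
      by (simp add: power_mult_distrib)
    moreover have "(x - Y n) - (x - Y m) = Y m - Y n" by simp
    ultimately have "4 * (norm (x - h))\<^sup>2 + (norm (Y m - Y n))\<^sup>2
        = 2 * (norm (x - Y n))\<^sup>2 + 2 * (norm (x - Y m))\<^sup>2"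
      using parallelogram[of "x - Y n" "x - Y m"] by metis
    then show ?thesis
      using d_le[OF \<open>h \<in> M\<close>] Y(2)[of n] Y(2)[of m] by (simp add: norm_minus_commute)
  qed
  have "Cauchy Y"
  proof (rule metric_CauchyI)
    fix e :: real assume "0 < e"
    then have "0 < e\<^sup>2 / 4" by simp
    then obtain K where K: "inverse (real (Suc K)) < e\<^sup>2 / 4"
      using reals_Archimedean by blast
    have "dist (Y m) (Y n) < e" if "m \<ge> K" "n \<ge> K" for m n
    proof -
      have "inverse (real (Suc k)) \<le> inverse (real (Suc K))" if "k \<ge> K" for k
        using that by (simp add: field_simps)
      from this[OF that(1)] this[OF that(2)] have "(norm (Y m - Y n))\<^sup>2 < e\<^sup>2"
        using close[of m n] K by linarith
      then show ?thesis
        unfolding dist_norm using \<open>0 < e\<close> by (meson less_imp_le power2_less_imp_less)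
    qed
    then show "\<exists>K. \<forall>m\<ge>K. \<forall>n\<ge>K. dist (Y m) (Y n) < e" by blast
  qed
  then obtain y where y: "Y \<longlonglongrightarrow> y"
    using Cauchy_convergent convergent_def by blast
  have "y \<in> M"
    by (rule closed_sequentially[OF closed_csubspaceD(1)[OF M] _ y]) (rule Y(1))
  have "(\<lambda>n. (norm (x - Y n))\<^sup>2) \<longlonglongrightarrow> (norm (x - y))\<^sup>2"
    by (intro tendsto_intros y)
  then have y_min: "(norm (x - y))\<^sup>2 \<le> d"
  proof (rule LIMSEQ_le)
    show "(\<lambda>n. d + inverse (real (Suc n))) \<longlonglongrightarrow> d"
      using tendsto_add[OF tendsto_const LIMSEQ_inverse_real_of_nat, of d] by simp
  qed (use Y(2) in \<open>auto intro!: less_imp_le\<close>)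
  have "cinner (x - y) w = 0" if "w \<in> M" for w
  proof (rule zero_if_quadratic_nonneg)
    fix t :: complex
    have "y - t *\<^sub>C w \<in> M"
      using M \<open>y \<in> M\<close> that by (intro closed_csubspaceD)
    from d_le[OF this] have "d \<le> (norm (x - y + t *\<^sub>C w))\<^sup>2"
      by (simp add: algebra_simps)
    then show "0 \<le> 2 * Re (cnj t * cinner (x - y) w) + (cmod t)\<^sup>2 * (norm w)\<^sup>2"
      using y_min by (simp add: norm_add_scaleC_square)
  qed
  with \<open>y \<in> M\<close> show ?thesis by blast
qed

lemma orth_proj:
  fixes x :: "'v::complex_hilbert_space"
  assumes M: "closed_csubspace M"
  shows "orth_proj M x \<in> M" "w \<in> M \<Longrightarrow> cinner (x - orth_proj M x) w = 0"
proof -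
  let ?P = "\<lambda>y. y \<in> M \<and> (\<forall>w\<in>M. cinner (x - y) w = 0)"
  obtain y where y: "?P y"
    using orthogonal_projection_exists[OF M] by blast
  have "z = y" if "?P z" for z
  proof -
    have "y - z \<in> M" using M y that by (simp add: closed_csubspaceD)
    then have "cinner (x - z) (y - z) - cinner (x - y) (y - z) = 0"
      using y that by simp
    then have "cinner (y - z) (y - z) = 0"
      by (simp add: cinner.diff_left)
    then show ?thesis by simp
  qed
  then have "?P (orth_proj M x)"
    unfolding orth_proj_def using y by (intro theI[of ?P]) auto
  then show "orth_proj M x \<in> M" "w \<in> M \<Longrightarrow> cinner (x - orth_proj M x) w = 0"
    by auto
qed

section \<open>Eigenvectors of compact normal operators\<close>

text \<open>Stated on images of bounded sequences, compactness passes from a normal operator to its adjoint,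
  and then to linear combinations of the two by a common subsequence.\<close>

definition seq_compact_op :: "('v::complex_hilbert_space \<Rightarrow> 'v) \<Rightarrow> bool"
  where "seq_compact_op A \<longleftrightarrow>
    (\<forall>X :: nat \<Rightarrow> 'v. bounded (range X) \<longrightarrow>
      (\<exists>r :: nat \<Rightarrow> nat. strict_mono r \<and> convergent (\<lambda>n. A (X (r n)))))"

text \<open>The norm of a compact symmetric operator is attained up to sign as an eigenvalue. Working inside
  an invariant subspace allows the lemma to be applied first to the real part of a normal operator
  and then to the imaginary part on the resulting eigenspace.\<close>

lemma symmetric_compact_eigenvector:
  fixes A :: "'v::complex_hilbert_space \<Rightarrow> 'v"
  assumes A: "linear_operator UNIV A" and bounded: "\<And>x. norm (A x) \<le> K * norm x"
    and sym: "\<And>x y. cinner (A x) y = cinner x (A y)" and compact: "seq_compact_op A"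
    and M: "closed_csubspace M" and inv: "\<And>x. x \<in> M \<Longrightarrow> A x \<in> M"
    and x0: "x0 \<in> M" "x0 \<noteq> 0"
  shows "\<exists>x\<in>M. \<exists>s::real. x \<noteq> 0 \<and> A x = complex_of_real s *\<^sub>C x"
proof -
  have add: "A (x + y) = A x + A y" and scale: "A (a *\<^sub>C x) = a *\<^sub>C A x" for x y a
    using A unfolding linear_operator_def by auto
  have scaleR: "A (r *\<^sub>R x) = r *\<^sub>R A x" for r x
    by (simp add: scaleR_scaleC scale)
  have lin: "bounded_linear A"
    by (rule bounded_linear_intro[where K = K])
      (use bounded in \<open>auto simp: add scaleR mult.commute\<close>)
  define U where "U = {x\<in>M. norm x = 1}"
  \<comment> \<open>The norm of the restriction of \<open>A\<close> to \<open>M\<close>: \<open>c\<close> or \<open>- c\<close> will be the eigenvalue.\<close>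
  define c where "c = (SUP x\<in>U. norm (A x))"
  have bdd: "bdd_above ((\<lambda>x. norm (A x)) ` U)"
    proof (rule bdd_aboveI2)
    show "norm (A x) \<le> K" if "x \<in> U" for x
      using bounded[of x] that unfolding U_def by simp
  qed
  have "(1 / norm x0) *\<^sub>R x0 \<in> U"
    unfolding U_def using x0 M by (simp add: closed_csubspace_scaleR)
  then have "U \<noteq> {}" by blast
  have c_ge: "norm (A x) \<le> c" if "x \<in> U" for x
    unfolding c_def using bdd that by (rule cSUP_upper2) simp
  have c_ge': "norm (A x) \<le> c * norm x" if "x \<in> M" for x
  proof (cases "x = 0")
    case True
    then show ?thesis using bounded[of x] by simp
  next
    case False
    have "(1 / norm x) *\<^sub>R x \<in> U"
      unfolding U_def using that False M by (simp add: closed_csubspace_scaleR)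
    from c_ge[OF this] False show ?thesis
      by (simp add: scaleR field_simps)
  qed
  have "0 \<le> c"
    using \<open>U \<noteq> {}\<close> c_ge norm_ge_zero order_trans by (metis all_not_in_conv)
  show ?thesis
  proof (cases "c = 0")
    case True
    then have "A x0 = 0"
      using c_ge'[OF x0(1)] by simp
    then show ?thesis
      using x0 by (intro bexI[of _ x0] exI[of _ 0]) auto
  next
    case False
    then have "0 < c" using \<open>0 \<le> c\<close> by simp
    have "\<exists>x\<in>U. c - inverse (real (Suc n)) < norm (A x)" for n
    proof -
      have "c - inverse (real (Suc n)) < (SUP x\<in>U. norm (A x))"
        unfolding c_def by simp
      then show ?thesis
        using bdd \<open>U \<noteq> {}\<close> by (subst (asm) less_cSUP_iff) auto
    qed
    then obtain X where X: "\<And>n. X n \<in> U" "\<And>n. c - inverse (real (Suc n)) < norm (A (X n))"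
      by metis
    have XM: "X n \<in> M" and Xn: "norm (X n) = 1" for n
      using X(1)[of n] unfolding U_def by auto
    have "bounded (range X)"
      unfolding bounded_iff using Xn by (intro exI[of _ 1]) auto
    then obtain r :: "nat \<Rightarrow> nat" where r: "strict_mono r" "convergent (\<lambda>n. A (X (r n)))"
      using compact[unfolded seq_compact_op_def, rule_format, of X] by auto
    then obtain y where y: "(\<lambda>n. A (X (r n))) \<longlonglongrightarrow> y"
      unfolding convergent_def by blast
    have "(\<lambda>n. norm (A (X n))) \<longlonglongrightarrow> c"
    proof (rule tendsto_sandwich[of "\<lambda>n. c - inverse (real (Suc n))" _ _ "\<lambda>_. c"])
      show "(\<lambda>n. c - inverse (real (Suc n))) \<longlonglongrightarrow> c"
        using tendsto_diff[OF tendsto_const LIMSEQ_inverse_real_of_nat, of c] by simp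
    qed (use X c_ge in \<open>auto intro!: always_eventually less_imp_le simp del: of_nat_Suc\<close>)
    then have nr: "(\<lambda>n. norm (A (X (r n)))) \<longlonglongrightarrow> c"
      using LIMSEQ_subseq_LIMSEQ[OF _ r(1)] by (force simp: o_def)
    have AAy: "(\<lambda>n. A (A (X (r n)))) \<longlonglongrightarrow> A y"
      by (rule bounded_linear.tendsto[OF lin y])
    \<comment> \<open>A maximising sequence consists of approximate eigenvectors of \<open>A\<^sup>2\<close> for \<open>c\<^sup>2\<close>;
        compactness then turns them into a true eigenvector.\<close>
    have sq: "(norm (A (A (X n)) - (c\<^sup>2) *\<^sub>R X n))\<^sup>2 \<le> c^4 - c\<^sup>2 * (norm (A (X n)))\<^sup>2" for n
    proof -
      have "cinner (A (A (X n))) (X n) = complex_of_real ((norm (A (X n)))\<^sup>2)"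
        by (simp add: sym[of "A (X n)"] cinner_self)
      then have "Re (cinner (A (A (X n))) (- (c\<^sup>2 *\<^sub>R X n))) = - (c\<^sup>2 * (norm (A (X n)))\<^sup>2)"
        by (simp add: cinner.minus_right cinner.scaleR_right del: of_real_power)
      moreover have "(norm (A (A (X n))))\<^sup>2 \<le> (c * norm (A (X n)))\<^sup>2"
        using c_ge'[OF inv[OF XM]] by (intro power_mono) auto
      moreover have "(norm (- (c\<^sup>2 *\<^sub>R X n)))\<^sup>2 = c ^ 4"
        by (simp add: Xn)
      ultimately show ?thesis
        using norm_add_square[of "A (A (X n))" "- (c\<^sup>2 *\<^sub>R X n)"]
        by (simp add: power_mult_distrib Xn)
    qed
    have "(\<lambda>n. c^4 - c\<^sup>2 * (norm (A (X (r n))))\<^sup>2) \<longlonglongrightarrow> c^4 - c\<^sup>2 * c\<^sup>2"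
      by (intro tendsto_intros nr)
    then have "(\<lambda>n. c^4 - c\<^sup>2 * (norm (A (X (r n))))\<^sup>2) \<longlonglongrightarrow> 0"
      by simp
    then have "(\<lambda>n. (norm (A (A (X (r n))) - (c\<^sup>2) *\<^sub>R X (r n)))\<^sup>2) \<longlonglongrightarrow> 0"
      by (rule Lim_null_comparison[rotated]) (use sq in simp)
    then have "(\<lambda>n. sqrt ((norm (A (A (X (r n))) - (c\<^sup>2) *\<^sub>R X (r n)))\<^sup>2)) \<longlonglongrightarrow> sqrt 0"
      by (rule tendsto_real_sqrt)
    then have "(\<lambda>n. A (A (X (r n))) - (c\<^sup>2) *\<^sub>R X (r n)) \<longlonglongrightarrow> 0"
      by (simp add: tendsto_norm_zero_iff)
    from tendsto_diff[OF AAy this]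
    have "(\<lambda>n. (c\<^sup>2) *\<^sub>R X (r n)) \<longlonglongrightarrow> A y" by simp
    from tendsto_scaleR[OF tendsto_const this, of "1 / c\<^sup>2"]
    have lim: "(\<lambda>n. X (r n)) \<longlonglongrightarrow> (1 / c\<^sup>2) *\<^sub>R A y"
      using False by simp
    define x where "x = (1 / c\<^sup>2) *\<^sub>R A y"
    have xl: "(\<lambda>n. X (r n)) \<longlonglongrightarrow> x"
      using lim unfolding x_def .
    have xM: "x \<in> M"
      by (rule closed_sequentially[OF closed_csubspaceD(1)[OF M] _ xl]) (rule XM)
    have "norm x = 1"
      using LIMSEQ_unique[OF tendsto_norm[OF xl]] by (simp add: Xn)
    then have "x \<noteq> 0" by auto
    have "A x = y"
      using LIMSEQ_unique[OF bounded_linear.tendsto[OF lin xl] y] .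
    then have AA: "A (A x) = c\<^sup>2 *\<^sub>R x"
      unfolding x_def using False by simp
    \<comment> \<open>Since \<open>A\<^sup>2 - c\<^sup>2 = (A - c) (A + c)\<close>, either \<open>w\<close> vanishes and \<open>x\<close> is an eigenvector for
        \<open>- c\<close>, or \<open>w\<close> is one for \<open>c\<close>.\<close>
    define w where "w = A x + c *\<^sub>R x"
    have wM: "w \<in> M"
      unfolding w_def using M xM inv by (simp add: closed_csubspaceD closed_csubspace_scaleR)
    have Aw: "A w = c *\<^sub>R w"
      unfolding w_def by (simp add: add scaleR AA scaleR_add_right power2_eq_square)
    show ?thesis
    proof (cases "w = 0")
      case True
      then have "A x = - (c *\<^sub>R x)"
        unfolding w_def by (simp add: eq_neg_iff_add_eq_0)
      then have "A x = complex_of_real (- c) *\<^sub>C x"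
        by (metis scaleR_minus_left scaleR_scaleC)
      then show ?thesis using xM \<open>x \<noteq> 0\<close> by blast
    next
      case False
      then show ?thesis using wM Aw by (metis scaleR_scaleC)
    qed
  qed
qed

lemma norm_adjoint_eq:
  fixes T :: "'v::complex_hilbert_space \<Rightarrow> 'v"
  assumes adj: "is_adjoint T T'" and comm: "T (T' x) = T' (T x)"
  shows "norm (T' x) = norm (T x)"
proof -
  have "cinner (T x) (T x) = cinner x (T' (T x))"
    using adj unfolding is_adjoint_def by blast
  also have "\<dots> = cnj (cinner (T (T' x)) x)"
    by (simp add: comm cinner_commute[of x])
  also have "\<dots> = cinner (T' x) (T' x)"
    using adj unfolding is_adjoint_def by (metis cinner_commute)
  finally show ?thesis
    by (simp add: cinner_self flip: of_real_power)
qed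

lemma adjoint_linear:
  fixes T :: "'v::complex_hilbert_space \<Rightarrow> 'v"
  assumes "is_adjoint T T'"
  shows "T' (x + y) = T' x + T' y" "T' (a *\<^sub>C x) = a *\<^sub>C T' x"
proof -
  have adj: "cinner x (T' y) = cinner (T x) y" for x y
    using assms unfolding is_adjoint_def by simp
  show "T' (x + y) = T' x + T' y"
    by (rule eq_if_cinner_eq) (simp add: adj cinner_add_right)
  show "T' (a *\<^sub>C x) = a *\<^sub>C T' x"
    by (rule eq_if_cinner_eq) (simp add: adj cinner_scaleC_right)
qed

lemma adjoint_swap: "is_adjoint T T' \<Longrightarrow> cinner (T' x) y = cinner x (T y)"
  unfolding is_adjoint_def by (metis cinner_commute)

text \<open>A common eigenvector of the commuting real and imaginary parts is an eigenvector of \<open>T\<close>. Finite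
  dimensional linear algebra is avoided, because both parts are compact and symmetric. Compactness of
  the adjoint comes from \<open>\<parallel>T' x\<parallel> = \<parallel>T x\<parallel>\<close>: it maps a sequence to a Cauchy sequence whenever \<open>T\<close> does.\<close>

lemma normal_compact_eigenvector:
  fixes T :: "'v::complex_hilbert_space \<Rightarrow> 'v"
  assumes T: "linear_operator UNIV T" and bounded: "\<And>x. norm (T x) \<le> K * norm x"
    and adj: "is_adjoint T T'" and comm: "\<And>x. T (T' x) = T' (T x)"
    and compact: "seq_compact_op T"
    and M: "closed_csubspace M" and inv: "\<And>x. x \<in> M \<Longrightarrow> T x \<in> M" "\<And>x. x \<in> M \<Longrightarrow> T' x \<in> M"
    and x0: "x0 \<in> M" "x0 \<noteq> 0"
  shows "\<exists>x\<in>M. \<exists>m. x \<noteq> 0 \<and> T x = m *\<^sub>C x"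
proof -
  have add: "T (x + y) = T x + T y" and scale: "T (a *\<^sub>C x) = a *\<^sub>C T x" for x y a
    using T unfolding linear_operator_def by auto
  note add' = adjoint_linear(1)[OF adj] and scale' = adjoint_linear(2)[OF adj]
  have diff: "T (x - y) = T x - T y" for x y
    by (metis add diff_conv_add_uminus minus_scaleC scale)
  have diff': "T' (x - y) = T' x - T' y" for x y
    by (metis add' diff_conv_add_uminus minus_scaleC scale')
  have norm_eq: "norm (T' x) = norm (T x)" for x
    using norm_adjoint_eq[OF adj comm] .
  have adj1: "cinner (T x) y = cinner x (T' y)" and adj2: "cinner (T' x) y = cinner x (T y)" for x y
    using adj adjoint_swap[OF adj] unfolding is_adjoint_def by auto
  \<comment> \<open>Up to scaling, the real and imaginary parts of \<open>T\<close>.\<close>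
  define A where "A x = T x + T' x" for x
  define B where "B x = \<i> *\<^sub>C (T x - T' x)" for x
  have compact2: "\<exists>r :: nat \<Rightarrow> nat. strict_mono r \<and> convergent (\<lambda>n. T (X (r n))) \<and> convergent (\<lambda>n. T' (X (r n)))"
    if bX: "bounded (range X)" for X :: "nat \<Rightarrow> 'v"
  proof -
    obtain r :: "nat \<Rightarrow> nat" where r: "strict_mono r" "convergent (\<lambda>n. T (X (r n)))"
      using compact[unfolded seq_compact_op_def, rule_format, OF bX] by auto
    then have "Cauchy (\<lambda>n. T (X (r n)))"
      by (simp add: convergent_Cauchy)
    moreover have "dist (T' x) (T' y) = dist (T x) (T y)" for x y
      by (simp add: dist_norm diff[symmetric] diff'[symmetric] norm_eq)
    ultimately have "Cauchy (\<lambda>n. T' (X (r n)))"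
      unfolding Cauchy_def by simp
    then show ?thesis
      using r Cauchy_convergent by blast
  qed
  have cA: "seq_compact_op A"
    unfolding seq_compact_op_def A_def using compact2 convergent_add by blast
  have cB: "seq_compact_op B"
    unfolding seq_compact_op_def
  proof (intro allI impI)
    fix X :: "nat \<Rightarrow> 'v" assume "bounded (range X)"
    then obtain r :: "nat \<Rightarrow> nat" where r: "strict_mono r" "convergent (\<lambda>n. T (X (r n)))" "convergent (\<lambda>n. T' (X (r n)))"
      using compact2 by blast
    obtain l where "(\<lambda>n. T (X (r n)) - T' (X (r n))) \<longlonglongrightarrow> l"
      using convergent_diff[OF r(2,3)] unfolding convergent_def by blast
    from scaleC.tendsto[OF tendsto_const this, of \<i>] have "convergent (\<lambda>n. B (X (r n)))"
      unfolding B_def convergent_def by blast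
    with r show "\<exists>r :: nat \<Rightarrow> nat. strict_mono r \<and> convergent (\<lambda>n. B (X (r n)))" by blast
  qed
  have linA: "linear_operator UNIV A"
    unfolding linear_operator_def A_def by (auto simp: add add' scale scale' scaleC_add_right)
  have linB: "linear_operator UNIV B"
    unfolding linear_operator_def B_def
    by (auto simp: add add' scale scale' scaleC_add_right scaleC.diff_right mult.commute algebra_simps)
  have bA: "norm (A x) \<le> (2 * K) * norm x" for x
    using norm_triangle_ineq[of "T x" "T' x"] bounded[of x] unfolding A_def by (simp add: norm_eq)
  have bB: "norm (B x) \<le> (2 * K) * norm x" for x
    using norm_triangle_ineq4[of "T x" "T' x"] bounded[of x] unfolding B_def
    by (simp add: norm_eq norm_scaleC)
  have symA: "cinner (A x) y = cinner x (A y)" for x y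
    unfolding A_def by (simp add: cinner_add_left cinner_add_right adj1 adj2)
  have symB: "cinner (B x) y = cinner x (B y)" for x y
    unfolding B_def
    by (simp add: cinner.diff_left cinner.diff_right cinner_scaleC_left cinner_scaleC_right adj1 adj2 algebra_simps)
  obtain x s where x: "x \<in> M" "x \<noteq> 0" "A x = complex_of_real s *\<^sub>C x"
    using symmetric_compact_eigenvector[OF linA bA symA cA M _ x0] inv M
    unfolding A_def by (blast dest: closed_csubspaceD(3))
  \<comment> \<open>The eigenspace of \<open>A\<close> in \<open>M\<close> is invariant under \<open>B\<close> because the two parts commute.\<close>
  define M' where "M' = M \<inter> {x. A x - complex_of_real s *\<^sub>C x = 0}"
  have blA: "bounded_linear A"
    by (rule bounded_linear_intro[where K = "2 * K"])
      (use bA linA in \<open>auto simp: linear_operator_def scaleR_scaleC mult.commute\<close>)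
  have "closed {x. A x - complex_of_real s *\<^sub>C x = 0}"
    by (intro closed_Collect_eq continuous_on_diff continuous_on_const
        bounded_linear.continuous_on[OF blA] scaleC.continuous_on continuous_on_id)
  then have M': "closed_csubspace M'"
    using M linA unfolding M'_def closed_csubspace_def linear_operator_def
    by (auto simp: scaleC_add_right mult.commute linear_simps(3)[OF blA])
  have invM': "B x \<in> M'" if "x \<in> M'" for x
  proof -
    have 1: "x \<in> M" "A x = complex_of_real s *\<^sub>C x"
      using that unfolding M'_def by auto
    have "A (B x) = B (A x)"
      unfolding A_def B_def by (simp add: add add' diff diff' scale scale' comm scaleC_add_right scaleC.diff_right)
    also have "\<dots> = complex_of_real s *\<^sub>C B x"
      using linB unfolding 1 linear_operator_def by auto
    finally show ?thesis
      using 1(1) M inv unfolding M'_def B_def by (auto intro!: closed_csubspaceD)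
  qed
  have xM': "x \<in> M'" using x unfolding M'_def by simp
  obtain u t where u: "u \<in> M'" "u \<noteq> 0" "B u = complex_of_real t *\<^sub>C u"
    using symmetric_compact_eigenvector[OF linB bB symB cB M' invM' xM' x(2)] by blast
  have Au: "A u = complex_of_real s *\<^sub>C u"
    using u unfolding M'_def by simp
  have "(-\<i>) *\<^sub>C B u = T u - T' u"
    unfolding B_def by simp
  then have "2 *\<^sub>C T u = A u + (-\<i>) *\<^sub>C B u"
    unfolding A_def using scaleC_add_left[of 1 1 "T u"] by simp
  also have "\<dots> = (complex_of_real s - \<i> * complex_of_real t) *\<^sub>C u"
    unfolding Au u(3) by (simp add: scaleC.diff_left scaleC.minus_left)
  finally have "(1/2) *\<^sub>C 2 *\<^sub>C T u = ((complex_of_real s - \<i> * complex_of_real t) / 2) *\<^sub>C u"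
    by simp
  then have "T u = ((complex_of_real s - \<i> * complex_of_real t) / 2) *\<^sub>C u"
    by simp
  then show ?thesis
    using u unfolding M'_def by blast
qed

section \<open>Eigenspaces of the unbounded operator\<close>

locale compact_normal_inverse =
  fixes D :: "'v::complex_hilbert_space set" and L :: "'v \<Rightarrow> 'v"
  assumes linear: "linear_operator D L"
    and bijective: "bij_betw L D UNIV"
    and inverse_compact: "compact_operator (inv_into D L)"
    and inverse_normal: "normal_operator (inv_into D L)"
begin

abbreviation T :: "'v \<Rightarrow> 'v" where "T \<equiv> inv_into D L"

abbreviation E :: "complex \<Rightarrow> 'v set" where "E \<equiv> eigenspace D L"

lemma T_in [simp]: "T x \<in> D" and L_T [simp]: "L (T x) = x"
  using bijective by (auto simp: bij_betw_def inv_into_into f_inv_into_f)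

lemma T_L: "u \<in> D \<Longrightarrow> T (L u) = u"
  using bijective by (simp add: bij_betw_def)

lemma linear_T: "linear_operator UNIV T"
  using inverse_compact by (simp add: compact_operator_def)

lemma T_add: "T (x + y) = T x + T y" and T_scaleC: "T (a *\<^sub>C x) = a *\<^sub>C T x"
  using linear_T by (auto simp: linear_operator_def)

lemma T_diff: "T (x - y) = T x - T y"
  using T_add[of x "- y"] T_scaleC[of "- 1" y] by (simp add: minus_scaleC[symmetric])

lemma T_scaleR: "T (r *\<^sub>R x) = r *\<^sub>R T x"
  by (simp add: scaleR_scaleC T_scaleC)

lemma T_bounded: "\<exists>K. \<forall>x. norm (T x) \<le> K * norm x"
proof -
  have "compact (closure (T ` cball 0 1))"
    using inverse_compact by (auto simp: compact_operator_def)
  then have "bounded (T ` cball 0 1)"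
    by (intro bounded_subset[OF compact_imp_bounded closure_subset])
  then obtain K where "\<forall>y\<in>T ` cball 0 1. norm y \<le> K"
    unfolding bounded_iff by blast
  then have K: "norm (T x) \<le> K" if "norm x \<le> 1" for x
    using that by simp
  have "norm (T x) \<le> K * norm x" for x
  proof (cases "x = 0")
    case True
    then show ?thesis using T_scaleR[of 0 0] by simp
  next
    case False
    then show ?thesis
      using K[of "(1 / norm x) *\<^sub>R x"] by (simp add: T_scaleR field_simps)
  qed
  then show ?thesis by blast
qed

lemma bounded_linear_T: "bounded_linear T"
proof -
  obtain K where "\<And>x. norm (T x) \<le> K * norm x"
    using T_bounded by blast
  then show ?thesis
    by (intro bounded_linear_intro[where K = K]) (auto simp: T_add T_scaleR mult.commute)
qed

lemma seq_compact_T: "seq_compact_op T"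
  unfolding seq_compact_op_def
proof (intro allI impI)
  fix X :: "nat \<Rightarrow> 'v" assume "bounded (range X)"
  then have "compact (closure (T ` range X))"
    using inverse_compact by (auto simp: compact_operator_def)
  then have "seq_compact (closure (T ` range X))"
    by (rule compact_imp_seq_compact)
  moreover have "\<forall>n. T (X n) \<in> closure (T ` range X)"
    by (intro allI subsetD[OF closure_subset]) simp
  ultimately obtain l r where "strict_mono (r :: nat \<Rightarrow> nat)" "((\<lambda>n. T (X n)) \<circ> r) \<longlonglongrightarrow> l"
    by (rule seq_compactE)
  then show "\<exists>r :: nat \<Rightarrow> nat. strict_mono r \<and> convergent (\<lambda>n. T (X (r n)))"
    unfolding convergent_def o_def by blast
qed

text \<open>The bounded inverse describes the eigenspaces of the unbounded operator, including the trivial one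
  for \<open>l = 0\<close>.\<close>

lemma eigenspace_iff: "v \<in> E l \<longleftrightarrow> l *\<^sub>C T v = v"
proof
  assume "v \<in> E l"
  then have "v \<in> D" "L v = l *\<^sub>C v" by (auto simp: eigenspace_def)
  then show "l *\<^sub>C T v = v"
    using T_L[of v] by (simp add: T_scaleC)
next
  assume v: "l *\<^sub>C T v = v"
  then have "T (l *\<^sub>C v) = v" by (simp add: T_scaleC)
  then show "v \<in> E l"
    unfolding eigenspace_def using T_in[of "l *\<^sub>C v"] L_T[of "l *\<^sub>C v"] by simp
qed

lemma spectrum_iff: "l \<in> spectrum D L \<longleftrightarrow> (\<exists>v\<in>E l. v \<noteq> 0)"
  by (auto simp: spectrum_def eigenspace_def)

lemma closed_csubspace_eigenspace: "closed_csubspace (E l)"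
proof -
  have "E l = {v. l *\<^sub>C T v = v}"
    using eigenspace_iff by auto
  moreover have "closed {v. l *\<^sub>C T v = v}"
    by (intro closed_Collect_eq bounded_linear.continuous_on[OF bounded_linear_T]
        scaleC.continuous_on continuous_on_const continuous_on_id)
  ultimately show ?thesis
    unfolding closed_csubspace_def
    by (auto simp: T_add T_scaleC scaleC_add_right linear_simps(3)[OF bounded_linear_T])
       (metis mult.commute scaleC_scaleC)
qed

definition T' :: "'v \<Rightarrow> 'v"
  where "T' = (SOME T'. is_adjoint T T' \<and> T \<circ> T' = T' \<circ> T)"

lemma T': "is_adjoint T T'" "T (T' x) = T' (T x)"
proof -
  have "is_adjoint T T' \<and> T \<circ> T' = T' \<circ> T"
    unfolding T'_def using inverse_normal unfolding normal_operator_def by (rule someI_ex)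
  then show "is_adjoint T T'" "T (T' x) = T' (T x)"
    by (auto simp: fun_eq_iff)
qed

lemma cinner_T: "cinner (T x) y = cinner x (T' y)"
  using T'(1) by (simp add: is_adjoint_def)

lemma cinner_T': "cinner (T' x) y = cinner x (T y)"
  using T'(1) by (rule adjoint_swap)

lemma T'_diff: "T' (x - y) = T' x - T' y"
  using adjoint_linear(1)[OF T'(1), of x "- y"] adjoint_linear(2)[OF T'(1), of "- 1" y]
  by (simp add: minus_scaleC[symmetric])

text \<open>Normality makes every eigenvector of the inverse an eigenvector of its adjoint. Hence distinct
  eigenspaces are orthogonal and their joint complement is invariant under both operators.\<close>

lemma eigenspace_adjoint:
  assumes "v \<in> E l"
  shows "cnj l *\<^sub>C T' v = v"
proof -
  \<comment> \<open>\<open>l T - I\<close> is normal as well, so it has the same kernel as its adjoint.\<close>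
  define A A' where "A x = l *\<^sub>C T x - x" and "A' x = cnj l *\<^sub>C T' x - x" for x
  have "is_adjoint A A'"
    unfolding is_adjoint_def A_def A'_def
    by (simp add: cinner.diff_left cinner.diff_right cinner_scaleC_left cinner_scaleC_right cinner_T)
  moreover have "A (A' v) = A' (A v)"
    unfolding A_def A'_def
    by (simp add: T_diff T'_diff T_scaleC adjoint_linear(2)[OF T'(1)] T'(2) scaleC.diff_right mult.commute)
  ultimately have "norm (A' v) = norm (A v)"
    by (rule norm_adjoint_eq)
  moreover have "A v = 0"
    unfolding A_def using assms eigenspace_iff by simp
  ultimately show ?thesis
    unfolding A'_def by simp
qed

lemma eigenspaces_orthogonal:
  assumes "u \<in> E l" "v \<in> E m" "l \<noteq> m"
  shows "cinner u v = 0"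
proof -
  have "m * cinner u v = m * cinner (l *\<^sub>C T u) v"
    using assms(1) eigenspace_iff by simp
  also have "\<dots> = l * cinner u (cnj m *\<^sub>C T' v)"
    by (simp add: cinner_scaleC_left cinner_scaleC_right cinner_T)
  also have "\<dots> = l * cinner u v"
    using eigenspace_adjoint[OF assms(2)] by simp
  finally show ?thesis
    using assms(3) by simp
qed

text \<open>Completeness of the eigenvectors: if their joint orthogonal complement were nonzero, it would
  contain an eigenvector, orthogonal to itself. An eigenvalue \<open>m\<close> of the inverse is nonzero by
  injectivity, so it comes from the eigenvalue \<open>1 / m\<close>.\<close>

lemma orthogonal_to_eigenspaces_eq_0:
  assumes w: "\<And>l v. v \<in> E l \<Longrightarrow> cinner w v = 0"
  shows "w = 0"
proof (rule ccontr)
  assume "w \<noteq> 0"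
  define M where "M = (\<Inter>l. \<Inter>v\<in>E l. {w. cinner w v = 0})"
  have M_iff: "x \<in> M \<longleftrightarrow> (\<forall>l. \<forall>v\<in>E l. cinner x v = 0)" for x
    unfolding M_def by auto
  have "closed M"
    unfolding M_def
    by (intro closed_INT ballI closed_Collect_eq cinner.continuous_on continuous_on_const continuous_on_id)
  then have M: "closed_csubspace M"
    unfolding closed_csubspace_def
    by (auto simp: M_iff cinner.zero_left cinner_add_left cinner_scaleC_left)
  have inv: "T x \<in> M" "T' x \<in> M" if "x \<in> M" for x
  proof -
    have "cinner (T x) v = 0 \<and> cinner (T' x) v = 0" if v: "v \<in> E l" for l v
    proof (cases "v = 0")
      case True
      then show ?thesis by (simp add: cinner.zero_right)
    next
      case False
      with v have l: "l \<noteq> 0" using eigenspace_iff by auto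
      have "l * cinner (T x) v = cinner x (cnj l *\<^sub>C T' v)" "cnj l * cinner (T' x) v = cinner x (l *\<^sub>C T v)"
        by (simp_all add: cinner_scaleC_right cinner_T cinner_T')
      then have "l * cinner (T x) v = cinner x v" "cnj l * cinner (T' x) v = cinner x v"
        using v eigenspace_adjoint[OF v] eigenspace_iff by simp_all
      then show ?thesis
        using l \<open>x \<in> M\<close> v unfolding M_iff by auto
    qed
    then show "T x \<in> M" "T' x \<in> M" unfolding M_iff by blast+
  qed
  have "w \<in> M" using w unfolding M_iff by blast
  obtain K where K: "\<And>x. norm (T x) \<le> K * norm x" using T_bounded by blast
  obtain x m where x: "x \<in> M" "x \<noteq> 0" "T x = m *\<^sub>C x"
    using normal_compact_eigenvector[OF linear_T K T'(1) T'(2) seq_compact_T M inv \<open>w \<in> M\<close> \<open>w \<noteq> 0\<close>]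
    by blast
  have "m \<noteq> 0"
  proof
    assume "m = 0"
    then have "T x = T 0" using x by (simp add: linear_simps(3)[OF bounded_linear_T])
    from arg_cong[OF this, of L] show False using x(2) by (simp only: L_T simp_thms)
  qed
  then have "x \<in> E (1 / m)"
    unfolding eigenspace_iff x(3) by simp
  then have "cinner x x = 0"
    using x(1) unfolding M_iff by blast
  then show False using x(2) by simp
qed

end

section \<open>Orthogonal series\<close>

locale orthogonal_series =
  fixes v :: "nat \<Rightarrow> 'v::complex_hilbert_space"
  assumes orthogonal: "i \<noteq> j \<Longrightarrow> cinner (v i) (v j) = 0"
begin

lemma norm_sum_square:
  assumes "finite I"
  shows "(norm (\<Sum>k\<in>I. c k *\<^sub>C v k))\<^sup>2 = (\<Sum>k\<in>I. (cmod (c k))\<^sup>2 * (norm (v k))\<^sup>2)"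
  using assms
proof (induction I rule: finite_induct)
  case (insert i I)
  have "cinner (v i) (v k) = 0" if "k \<in> I" for k
    using insert.hyps(2) that by (intro orthogonal) auto
  then have "cinner (c i *\<^sub>C v i) (\<Sum>k\<in>I. c k *\<^sub>C v k) = 0"
    by (simp add: cinner.sum_right cinner_scaleC_left cinner_scaleC_right)
  then show ?case
    using insert by (simp add: norm_add_square norm_scaleC power_mult_distrib)
qed simp

end

locale square_summable_orthogonal_series = orthogonal_series +
  assumes square_summable: "summable (\<lambda>k. (norm (v k))\<^sup>2)"
begin

definition l2_norm :: real where "l2_norm = sqrt (\<Sum>k. (norm (v k))\<^sup>2)"

lemma l2_norm_nonneg: "0 \<le> l2_norm"
  unfolding l2_norm_def using square_summable by (simp add: suminf_nonneg)

lemma norm_sum_square_le: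
  assumes "finite I" "\<And>k. cmod (c k) \<le> B"
  shows "(norm (\<Sum>k\<in>I. c k *\<^sub>C v k))\<^sup>2 \<le> B\<^sup>2 * (\<Sum>k\<in>I. (norm (v k))\<^sup>2)"
  unfolding norm_sum_square[OF assms(1)] sum_distrib_left
  by (intro sum_mono mult_right_mono power_mono assms(2)) auto

lemma summable_scaleC:
  assumes B: "\<And>k. cmod (c k) \<le> B"
  shows "summable (\<lambda>k. c k *\<^sub>C v k)"
  unfolding summable_Cauchy
proof (intro allI impI)
  fix e :: real assume "0 < e"
  have B0: "0 \<le> B" using B norm_ge_zero order_trans by blast
  then have "0 < e\<^sup>2 / (B\<^sup>2 + 1)" using \<open>0 < e\<close> by (simp add: add_nonneg_pos)
  then obtain M where M: "\<And>m n. m \<ge> M \<Longrightarrow> norm (\<Sum>k=m..<n. (norm (v k))\<^sup>2) < e\<^sup>2 / (B\<^sup>2 + 1)"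
    using square_summable unfolding summable_Cauchy by meson
  have "norm (\<Sum>k=m..<n. c k *\<^sub>C v k) < e" if "m \<ge> M" for m n
  proof -
    have "(norm (\<Sum>k=m..<n. c k *\<^sub>C v k))\<^sup>2 \<le> B\<^sup>2 * (\<Sum>k=m..<n. (norm (v k))\<^sup>2)"
      using B by (intro norm_sum_square_le) auto
    also have "\<dots> \<le> (B\<^sup>2 + 1) * (\<Sum>k=m..<n. (norm (v k))\<^sup>2)"
      by (intro mult_right_mono sum_nonneg) auto
    also have "\<dots> < (B\<^sup>2 + 1) * (e\<^sup>2 / (B\<^sup>2 + 1))"
      using M[OF that, of n] by (intro mult_strict_left_mono) (auto simp: add_nonneg_pos)
    also have "\<dots> = e\<^sup>2"
      by (simp add: add_nonneg_eq_0_iff)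
    finally show ?thesis
      using \<open>0 < e\<close> by (meson less_imp_le power2_less_imp_less)
  qed
  then show "\<exists>M. \<forall>m\<ge>M. \<forall>n. norm (\<Sum>k=m..<n. c k *\<^sub>C v k) < e" by blast
qed

text \<open>This bound and the next identity are all that is used of Parseval's identity: the bound controls
  tails, and the pairing with a single term extracts a coefficient.\<close>

lemma norm_suminf_le:
  assumes B: "\<And>k. cmod (c k) \<le> B"
  shows "norm (\<Sum>k. c k *\<^sub>C v k) \<le> B * l2_norm"
proof (rule Lim_bounded)
  have B0: "0 \<le> B" using B norm_ge_zero order_trans by blast
  show "(\<lambda>n. norm (\<Sum>k<n. c k *\<^sub>C v k)) \<longlonglongrightarrow> norm (\<Sum>k. c k *\<^sub>C v k)"
    by (intro tendsto_norm summable_LIMSEQ summable_scaleC[OF B])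
  show "\<forall>n\<ge>0. norm (\<Sum>k<n. c k *\<^sub>C v k) \<le> B * l2_norm"
  proof (intro allI impI)
    fix n
    have "(norm (\<Sum>k<n. c k *\<^sub>C v k))\<^sup>2 \<le> B\<^sup>2 * (\<Sum>k<n. (norm (v k))\<^sup>2)"
      using B by (intro norm_sum_square_le) auto
    also have "\<dots> \<le> B\<^sup>2 * (\<Sum>k. (norm (v k))\<^sup>2)"
      using square_summable by (intro mult_left_mono sum_le_suminf) auto
    also have "\<dots> = (B * l2_norm)\<^sup>2"
      unfolding l2_norm_def using square_summable by (simp add: power_mult_distrib suminf_nonneg)
    finally show "norm (\<Sum>k<n. c k *\<^sub>C v k) \<le> B * l2_norm"
      by (rule power2_le_imp_le) (simp add: B0 l2_norm_nonneg)
  qed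
qed

lemma cinner_suminf:
  assumes B: "\<And>k. cmod (c k) \<le> B"
  shows "cinner (\<Sum>k. c k *\<^sub>C v k) (v j) = c j * complex_of_real ((norm (v j))\<^sup>2)"
proof -
  have "cinner (\<Sum>k. c k *\<^sub>C v k) (v j) = (\<Sum>k. cinner (c k *\<^sub>C v k) (v j))"
    by (intro bounded_linear.suminf[OF cinner.bounded_linear_left] summable_scaleC[OF B])
  also have "\<dots> = (\<Sum>k\<in>{j}. cinner (c k *\<^sub>C v k) (v j))"
    by (rule suminf_finite) (auto simp: cinner_scaleC_left orthogonal)
  finally show ?thesis
    by (simp add: cinner_scaleC_left cinner_self)
qed

end

section \<open>Spectral expansion of vectors and solutions\<close>

context compact_normal_inverse
begin

text \<open>Bessel's inequality gives convergence, and completeness identifies the limit.\<close>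

lemma eigenprojections:
  assumes mu: "inj mu" "range mu = spectrum D L"
  shows "square_summable_orthogonal_series (\<lambda>k::nat. orth_proj (E (mu k)) x)"
    and "(\<lambda>k. orth_proj (E (mu k)) x) sums x"
proof -
  define v where "v k = orth_proj (E (mu k)) x" for k
  have vE: "v k \<in> E (mu k)" and xv: "u \<in> E (mu k) \<Longrightarrow> cinner (x - v k) u = 0" for k u
    unfolding v_def using orth_proj[OF closed_csubspace_eigenspace] by auto
  interpret orthogonal_series v
    using vE mu(1) by unfold_locales (metis eigenspaces_orthogonal injD)
  \<comment> \<open>Partial sums already have the right component in each eigenspace that they include.\<close>
  have rest: "cinner (x - (\<Sum>k<n. v k)) u = 0" if "u \<in> E (mu j)" "j < n" for u j n
  proof -
    have "(\<Sum>k\<in>{..<n}. cinner (v k) u) = (\<Sum>k\<in>{j}. cinner (v k) u)"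
    proof (rule sum.mono_neutral_right)
      show "\<forall>k\<in>{..<n} - {j}. cinner (v k) u = 0"
        using mu(1) that(1) vE by (metis DiffD2 eigenspaces_orthogonal injD singletonI)
    qed (use that in auto)
    then show ?thesis
      using xv[OF that(1)] by (simp add: cinner.diff_left cinner.sum_left)
  qed
  have bessel: "(\<Sum>k<n. (norm (v k))\<^sup>2) \<le> (norm x)\<^sup>2" for n
  proof -
    define s where "s = (\<Sum>k<n. v k)"
    have "cinner (x - s) s = (\<Sum>k<n. cinner (x - s) (v k))"
      unfolding s_def by (rule cinner.sum_right)
    also have "\<dots> = 0"
      unfolding s_def using rest vE by (intro sum.neutral) auto
    finally have "(norm ((x - s) + s))\<^sup>2 = (norm (x - s))\<^sup>2 + (norm s)\<^sup>2"
      unfolding norm_add_square by simp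
    moreover have "(norm s)\<^sup>2 = (\<Sum>k<n. (norm (v k))\<^sup>2)"
      unfolding s_def using norm_sum_square[of "{..<n}" "\<lambda>_. 1"] by simp
    ultimately show ?thesis by simp
  qed
  have "summable (\<lambda>k. (norm (v k))\<^sup>2)"
    by (rule summableI_nonneg_bounded[where x = "(norm x)\<^sup>2"]) (use bessel in auto)
  then interpret square_summable_orthogonal_series v
    by unfold_locales
  show "square_summable_orthogonal_series (\<lambda>k::nat. orth_proj (E (mu k)) x)"
    using square_summable_orthogonal_series_axioms unfolding v_def .
  have "summable v"
    using summable_scaleC[of "\<lambda>_. 1" 1] by simp
  have "x - suminf v = 0"
  proof (rule orthogonal_to_eigenspaces_eq_0)
    fix l u assume u: "u \<in> E l"
    show "cinner (x - suminf v) u = 0"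
    proof (cases "u = 0")
      case False
      then obtain j where j: "l = mu j"
        using u spectrum_iff mu(2) by blast
      have "(\<lambda>n. cinner (x - (\<Sum>k<n. v k)) u) \<longlonglongrightarrow> cinner (x - suminf v) u"
        by (intro cinner.tendsto tendsto_diff tendsto_const summable_LIMSEQ \<open>summable v\<close>)
      moreover have "\<forall>\<^sub>F n in sequentially. cinner (x - (\<Sum>k<n. v k)) u = 0"
        using eventually_gt_at_top[of j] by eventually_elim (use rest u j in blast)
      then have "(\<lambda>n. cinner (x - (\<Sum>k<n. v k)) u) \<longlonglongrightarrow> 0"
        by (rule tendsto_eventually)
      ultimately show ?thesis
        using LIMSEQ_unique by blast
    qed (simp add: cinner.zero_right)
  qed
  then show "(\<lambda>k. orth_proj (E (mu k)) x) sums x"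
    using summable_sums[OF \<open>summable v\<close>] unfolding v_def by simp
qed

text \<open>The resolvent acts on each eigenspace as division by \<open>mu k - z\<close>.\<close>

lemma solution_eq_series:
  assumes mu: "inj mu" "range mu = spectrum D L" and "0 < \<epsilon>" and away: "\<And>k. \<epsilon> \<le> cmod (mu k - z)"
  shows "solution D L x z = (\<Sum>k. (1 / (mu k - z)) *\<^sub>C orth_proj (E (mu k)) x)"
proof -
  define v where "v k = orth_proj (E (mu k)) x" for k
  interpret square_summable_orthogonal_series v
    unfolding v_def using eigenprojections(1)[OF mu] .
  have nz: "mu k - z \<noteq> 0" for k
    using away[of k] \<open>0 < \<epsilon>\<close> by auto
  have b1: "cmod (1 / (mu k - z)) \<le> 1 / \<epsilon>" for k
    using away[of k] \<open>0 < \<epsilon>\<close> nz[of k] by (simp add: norm_divide frac_le)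
  have b2: "cmod (mu k / (mu k - z)) \<le> 1 + cmod z / \<epsilon>" for k
  proof -
    have "mu k / (mu k - z) = 1 + z * (1 / (mu k - z))"
      using nz[of k] by (simp add: field_simps)
    then have "cmod (mu k / (mu k - z)) \<le> 1 + cmod z * cmod (1 / (mu k - z))"
      by (metis norm_mult norm_one norm_triangle_ineq)
    then show ?thesis
      using mult_left_mono[OF b1[of k] norm_ge_zero[of z]] by simp
  qed
  define u where "u = (\<Sum>k. (1 / (mu k - z)) *\<^sub>C v k)"
  \<comment> \<open>\<open>w\<close> is the candidate for \<open>L u\<close>. As \<open>T\<close> is continuous and \<open>L\<close> need not be, the equation is
      verified in the form \<open>T w = u\<close>, which also puts \<open>u\<close> into the domain.\<close>
  define w where "w = (\<Sum>k. (mu k / (mu k - z)) *\<^sub>C v k)"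
  have Tv: "mu k *\<^sub>C T (v k) = v k" for k
    using orth_proj(1)[OF closed_csubspace_eigenspace, of "mu k" x] eigenspace_iff
    unfolding v_def by blast
  have "T w = (\<Sum>k. T ((mu k / (mu k - z)) *\<^sub>C v k))"
    unfolding w_def by (intro bounded_linear.suminf[OF bounded_linear_T] summable_scaleC[OF b2])
  also have "\<dots> = u"
    unfolding u_def
  proof (rule suminf_cong)
    show "T ((mu k / (mu k - z)) *\<^sub>C v k) = (1 / (mu k - z)) *\<^sub>C v k" for k
      by (subst (2) Tv[symmetric]) (simp add: T_scaleC)
  qed
  finally have "T w = u" .
  then have u: "u \<in> D" "L u = w" by auto
  have "w - z *\<^sub>C u = (\<Sum>k. (mu k / (mu k - z)) *\<^sub>C v k - z *\<^sub>C (1 / (mu k - z)) *\<^sub>C v k)"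
    unfolding w_def u_def bounded_linear.suminf[OF scaleC.bounded_linear_right summable_scaleC[OF b1]]
    by (intro suminf_diff bounded_linear.summable[OF scaleC.bounded_linear_right]
        summable_scaleC[OF b1] summable_scaleC[OF b2])
  also have "\<dots> = suminf v"
  proof (rule suminf_cong)
    fix k
    have "(mu k / (mu k - z)) *\<^sub>C v k - z *\<^sub>C (1 / (mu k - z)) *\<^sub>C v k
        = (mu k / (mu k - z) - z * (1 / (mu k - z))) *\<^sub>C v k"
      by (simp add: scaleC.diff_left)
    also have "mu k / (mu k - z) - z * (1 / (mu k - z)) = 1"
      using nz[of k] by (simp add: diff_divide_distrib[symmetric])
    finally show "(mu k / (mu k - z)) *\<^sub>C v k - z *\<^sub>C (1 / (mu k - z)) *\<^sub>C v k = v k" by simp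
  qed
  also have "\<dots> = x"
    using eigenprojections(2)[OF mu, of x] unfolding v_def by (rule sums_unique[symmetric])
  finally have eq: "L u - z *\<^sub>C u = x" using u by simp
  have unique: "y = u" if "y \<in> D" "L y - z *\<^sub>C y = x" for y
  proof (rule ccontr)
    assume "y \<noteq> u"
    have "L y = x + z *\<^sub>C y" "L u = x + z *\<^sub>C u"
      using that eq by (auto simp: algebra_simps)
    then have "L y - L u = z *\<^sub>C (y - u)"
      by (simp add: scaleC.diff_right)
    moreover have "y - u = T (L y - L u)"
      using T_L[OF that(1)] T_L[OF u(1)] by (simp only: T_diff)
    ultimately have "z *\<^sub>C T (y - u) = y - u"
      by (metis T_scaleC)
    then have "z \<in> spectrum D L"
      using \<open>y \<noteq> u\<close> unfolding spectrum_iff by (intro bexI[of _ "y - u"]) (simp_all add: eigenspace_iff)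
    then obtain k where "z = mu k" unfolding mu(2)[symmetric] by (rule rangeE)
    then show False using nz by auto
  qed
  have "solution D L x z = u"
    unfolding solution_def
  proof (rule the_equality)
    show "u \<in> D \<and> L u - z *\<^sub>C u = x"
      using u(1) eq by (rule conjI)
    show "y = u" if "y \<in> D \<and> L y - z *\<^sub>C y = x" for y
      using that by (elim conjE) (rule unique)
  qed
  then show ?thesis
    unfolding u_def v_def .
qed

end

section \<open>Derivatives of orthogonal series\<close>

lemma vderivI:
  assumes "((\<lambda>h. inverse h *\<^sub>C (F (z + h) - F z)) \<longlongrightarrow> d) (at 0)"
  shows "vderiv F z = d"
  unfolding vderiv_def using assms by (intro tendsto_Lim) auto

context square_summable_orthogonal_series
begin

text \<open>Termwise differentiation. On slightly smaller discs the Cauchy estimates bound every derivative of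
  the coefficients uniformly in \<open>k\<close>, so the second-order Taylor remainders are \<open>O(h\<^sup>2)\<close> uniformly, and
  orthogonality turns uniform bounds on coefficients into bounds on the sum.\<close>

lemma vderiv_funpow_suminf:
  assumes hol: "\<And>k. c k holomorphic_on ball z0 r"
    and bound: "\<And>k w. w \<in> ball z0 r \<Longrightarrow> cmod (c k w) \<le> B"
    and F: "\<And>w. w \<in> ball z0 r \<Longrightarrow> F w = (\<Sum>k. c k w *\<^sub>C v k)"
    and z: "z \<in> ball z0 r"
  shows "(vderiv ^^ n) F z = (\<Sum>k. (deriv ^^ n) (c k) z *\<^sub>C v k)"
  using z
proof (induction n arbitrary: z)
  case 0
  then show ?case using F by simp
next
  case (Suc n)
  \<comment> \<open>With half the distance to the boundary, discs of radius \<open>s\<close> around points of \<open>ball z s\<close>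
      stay inside the domain, as the Cauchy estimate requires.\<close>
  define s where "s = (r - dist z0 z) / 2"
  have s: "0 < s" using Suc.prems unfolding s_def by simp
  have sub: "cball w s \<subseteq> ball z0 r" if "w \<in> ball z s" for w
  proof
    fix u assume "u \<in> cball w s"
    then have "dist z0 u < dist z0 z + s + s"
      using that dist_triangle[of z0 u z] dist_triangle[of z u w] by simp
    then show "u \<in> ball z0 r" unfolding s_def by simp
  qed
  have Cauchy: "cmod ((deriv ^^ m) (c k) w) \<le> fact m * B / s ^ m" if w: "w \<in> ball z s" for m k w
  proof (rule Cauchy_inequality)
    show "c k holomorphic_on ball w s"
      by (rule holomorphic_on_subset[OF hol]) (use sub[OF w] ball_subset_cball in blast)
    show "continuous_on (cball w s) (c k)"
      by (intro holomorphic_on_imp_continuous_on holomorphic_on_subset[OF hol] sub[OF w])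
    show "cmod (c k x) \<le> B" if "cmod (w - x) = s" for x
      using sub[OF w] that by (intro bound) (auto simp: dist_norm)
  qed (rule s)
  \<comment> \<open>The Cauchy estimate for the second derivative of the \<open>n\<close>-th derivative, uniform in \<open>k\<close>.\<close>
  define C where "C = fact (n + 2) * B / s ^ (n + 2)"
  have zs: "z \<in> ball z s" using s by simp
  have remainder: "cmod ((deriv ^^ n) (c k) (z + h) - (deriv ^^ n) (c k) z - h * (deriv ^^ Suc n) (c k) z)
      \<le> C * (cmod h)\<^sup>2" if h: "cmod h < s" for h k
  proof -
    have "cmod ((deriv ^^ (n + 0)) (c k) (z + h) -
        (\<Sum>i\<le>1. (deriv ^^ (n + i)) (c k) z * (z + h - z) ^ i / fact i)) \<le> C * cmod (z + h - z) ^ Suc 1 / fact 1"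
    proof (rule complex_Taylor[where S = "ball z s"])
      fix i x assume x: "x \<in> ball z s"
      have "x \<in> ball z0 r"
        using subsetD[OF sub[OF x], of x] s by simp
      moreover have "(deriv ^^ (n + i)) (c k) holomorphic_on ball z0 r"
        by (intro holomorphic_higher_deriv hol open_ball)
      ultimately show "((deriv ^^ (n + i)) (c k) has_field_derivative (deriv ^^ (n + Suc i)) (c k) x) (at x within ball z s)"
        by (auto intro!: DERIV_subset[OF holomorphic_derivI])
    next
      show "cmod ((deriv ^^ (n + Suc 1)) (c k) x) \<le> C" if "x \<in> ball z s" for x
        using Cauchy[OF that, of "n + 2" k] unfolding C_def Suc_1 .
    qed (use s h in \<open>auto simp: dist_norm\<close>)
    then show ?thesis
      by (simp add: power2_eq_square algebra_simps)
  qed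
  have summ: "summable (\<lambda>k. (deriv ^^ m) (c k) w *\<^sub>C v k)" if "w \<in> ball z s" for m w
    using Cauchy[OF that] by (intro summable_scaleC)
  define F' where "F' = (\<Sum>k. (deriv ^^ Suc n) (c k) z *\<^sub>C v k)"
  have est: "norm (inverse h *\<^sub>C ((vderiv ^^ n) F (z + h) - (vderiv ^^ n) F z) - F') \<le> C * l2_norm * cmod h"
    if h: "cmod h < s" "h \<noteq> 0" for h
  proof -
    have zh: "z + h \<in> ball z s" using h by (simp add: dist_norm)
    have "z + h \<in> ball z0 r" using subsetD[OF sub[OF zh], of "z + h"] s by simp
    define R where "R = (vderiv ^^ n) F (z + h) - (vderiv ^^ n) F z - h *\<^sub>C F'"
    have "R = (\<Sum>k. ((deriv ^^ n) (c k) (z + h) - (deriv ^^ n) (c k) z - h * (deriv ^^ Suc n) (c k) z) *\<^sub>C v k)"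
      unfolding R_def F'_def Suc.IH[OF \<open>z + h \<in> ball z0 r\<close>] Suc.IH[OF Suc.prems]
      unfolding scaleC.diff_left scaleC_scaleC[symmetric]
      by (simp only: suminf_diff[symmetric] summable_diff summ[OF zs] summ[OF zh]
          bounded_linear.summable[OF scaleC.bounded_linear_right]
          bounded_linear.suminf[OF scaleC.bounded_linear_right])
    then have "norm R \<le> C * (cmod h)\<^sup>2 * l2_norm"
      using remainder[OF h(1)] by (simp only:) (intro norm_suminf_le)
    moreover have "inverse h *\<^sub>C ((vderiv ^^ n) F (z + h) - (vderiv ^^ n) F z) - F' = inverse h *\<^sub>C R"
      unfolding R_def using h(2) by (simp add: scaleC.diff_right)
    moreover have "norm (inverse h *\<^sub>C R) = norm R / cmod h"
      by (simp add: norm_scaleC norm_inverse divide_inverse mult.commute)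
    moreover have "C * (cmod h)\<^sup>2 * l2_norm / cmod h = C * l2_norm * cmod h"
      using h(2) by (simp add: power2_eq_square)
    ultimately show ?thesis
      using divide_right_mono[of "norm R" "C * (cmod h)\<^sup>2 * l2_norm" "cmod h"] by simp
  qed
  have "vderiv ((vderiv ^^ n) F) z = F'"
  proof (rule vderivI, rule LIM_zero_cancel)
    show "((\<lambda>h. inverse h *\<^sub>C ((vderiv ^^ n) F (z + h) - (vderiv ^^ n) F z) - F') \<longlongrightarrow> 0) (at 0)"
    proof (rule Lim_null_comparison)
      show "\<forall>\<^sub>F h in at 0. norm (inverse h *\<^sub>C ((vderiv ^^ n) F (z + h) - (vderiv ^^ n) F z) - F') \<le> C * l2_norm * cmod h"
        unfolding eventually_at using s est by (intro exI[of _ s]) auto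
      show "((\<lambda>h. C * l2_norm * cmod h) \<longlongrightarrow> 0) (at 0)"
        by (auto intro!: tendsto_eq_intros)
    qed
  qed
  then show ?case
    unfolding F'_def by simp
qed

end

lemma deriv_poly: "deriv (poly p) = poly (pderiv p)" for p :: "complex poly"
  by (intro ext DERIV_imp_deriv poly_DERIV)

lemma higher_deriv_poly: "(deriv ^^ n) (poly p) = poly ((pderiv ^^ n) p)" for p :: "complex poly"
  by (induction n) (auto simp: deriv_poly)

lemma higher_deriv_inverse_diff:
  fixes z \<mu> :: complex
  assumes "z \<noteq> \<mu>"
  shows "(deriv ^^ n) (\<lambda>z. inverse (\<mu> - z)) z = fact n * inverse (\<mu> - z) ^ Suc n"
  using assms
proof (induction n arbitrary: z)
  case (Suc n)
  have "((\<lambda>z. inverse (\<mu> - z)) has_field_derivative (inverse (\<mu> - z))\<^sup>2) (at z)"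
    using Suc.prems by (auto intro!: derivative_eq_intros simp: power2_eq_square)
  from DERIV_cmult[OF DERIV_power[OF this, of "Suc n"], of "fact n"]
  have "((\<lambda>z. fact n * inverse (\<mu> - z) ^ Suc n) has_field_derivative fact (Suc n) * inverse (\<mu> - z) ^ Suc (Suc n)) (at z)"
    by (simp add: power2_eq_square algebra_simps)
  then have "((deriv ^^ n) (\<lambda>z. inverse (\<mu> - z)) has_field_derivative fact (Suc n) * inverse (\<mu> - z) ^ Suc (Suc n)) (at z)"
    by (rule has_field_derivative_transform_within_open[where S = "- {\<mu>}"]) (use Suc in auto)
  then show ?case
    by (simp add: DERIV_imp_deriv)
qed simp

text \<open>Up to a polynomial of degree below \<open>n\<close>, the function is \<open>p(\<mu>) / (\<mu> - z)\<close>. This is where the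
  requirement that the number of derivatives is at least the degree of the denominator enters.\<close>

lemma higher_deriv_poly_over_linear:
  fixes z \<mu> :: complex
  assumes deg: "degree p \<le> n" and z: "z \<noteq> \<mu>"
  shows "(deriv ^^ n) (\<lambda>z. poly p z / (\<mu> - z)) z = fact n * (poly p \<mu> / (\<mu> - z) ^ Suc n)"
proof -
  \<comment> \<open>Splitting off the principal part leaves the quotient \<open>q\<close>, which is zero or of degree below \<open>n\<close>.\<close>
  define q where "q = synthetic_div p \<mu>"
  have p: "poly p w = (w - \<mu>) * poly q w + poly p \<mu>" for w
    using arg_cong[OF synthetic_div_correct'[of \<mu> p], of "\<lambda>p. poly p w"] unfolding q_def
    by (simp add: algebra_simps)
  have split: "poly p w / (\<mu> - w) = poly p \<mu> * inverse (\<mu> - w) - poly q w" if "w \<noteq> \<mu>" for w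
    by (subst p) (use that in \<open>simp add: field_simps\<close>)
  have q: "(pderiv ^^ n) q = 0"
  proof (cases "q = 0")
    case False
    then have "0 < degree p"
      unfolding q_def by (simp add: synthetic_div_eq_0_iff)
    then have "degree q < n"
      unfolding q_def using deg by (simp add: degree_synthetic_div)
    then show ?thesis
      by (intro poly_eqI) (simp add: coeff_higher_pderiv coeff_eq_0)
  qed simp
  have open': "open (- {\<mu>})" and z': "z \<in> - {\<mu>}" using z by auto
  have hol: "(\<lambda>w. inverse (\<mu> - w)) holomorphic_on - {\<mu>}"
    by (intro holomorphic_intros) auto
  have "(deriv ^^ n) (\<lambda>z. poly p z / (\<mu> - z)) z = (deriv ^^ n) (\<lambda>w. poly p \<mu> * inverse (\<mu> - w) - poly q w) z"
    by (rule higher_deriv_transform_within_open[OF _ _ open' z'])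
      (auto intro!: holomorphic_intros split)
  also have "\<dots> = (deriv ^^ n) (\<lambda>w. poly p \<mu> * inverse (\<mu> - w)) z - (deriv ^^ n) (poly q) z"
    by (rule higher_deriv_diff[OF _ _ open' z']) (auto intro!: holomorphic_intros)
  also have "(deriv ^^ n) (\<lambda>w. poly p \<mu> * inverse (\<mu> - w)) z = poly p \<mu> * (deriv ^^ n) (\<lambda>w. inverse (\<mu> - w)) z"
    by (rule higher_deriv_cmult[OF hol z' open'])
  also have "(deriv ^^ n) (poly q) z = 0"
    by (simp add: higher_deriv_poly q)
  finally show ?thesis
    using z by (simp add: higher_deriv_inverse_diff power_inverse divide_inverse)
qed

section \<open>Polynomials expanded at a point\<close>

definition shifted_coeff :: "complex \<Rightarrow> complex poly \<Rightarrow> nat \<Rightarrow> complex"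
  where "shifted_coeff z0 P = coeff (pcompose P [:z0, 1:])"

lemma shifted_coeff_add: "shifted_coeff z0 (P + R) j = shifted_coeff z0 P j + shifted_coeff z0 R j"
  and shifted_coeff_smult: "shifted_coeff z0 (smult a P) j = a * shifted_coeff z0 P j"
  by (simp_all add: shifted_coeff_def pcompose_add pcompose_smult)

lemma shifted_coeff_sum: "shifted_coeff z0 (\<Sum>i\<in>I. f i) j = (\<Sum>i\<in>I. shifted_coeff z0 (f i) j)"
  by (simp add: shifted_coeff_def pcompose_sum coeff_sum)

lemma pcompose_shift_inverse: "pcompose (pcompose P [:a, 1:]) [:- a, 1:] = P" for P :: "complex poly"
  by (simp add: pcompose_assoc[symmetric] pcompose_pCons)

lemma pcompose_power: "pcompose (P ^ n) R = pcompose P R ^ n" for P R :: "complex poly"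
  by (induction n) (simp_all add: pcompose_1 pcompose_mult)

lemma shifted_expansion:
  assumes "degree P \<le> n"
  shows "P = (\<Sum>j\<le>n. smult (shifted_coeff z0 P j) ([:- z0, 1:] ^ j))"
proof -
  have deg: "degree (pcompose P [:z0, 1:]) \<le> n"
    using assms by (simp add: degree_pcompose)
  have mono: "pcompose (monom a j) [:- z0, 1:] = smult a ([:- z0, 1:] ^ j)" for a :: complex and j
    by (simp add: monom_altdef pcompose_smult pcompose_power pcompose_pCons)
  have "P = pcompose (pcompose P [:z0, 1:]) [:- z0, 1:]"
    by (simp add: pcompose_shift_inverse)
  also have "pcompose P [:z0, 1:] = (\<Sum>j\<le>n. monom (shifted_coeff z0 P j) j)"
    using poly_as_sum_of_monoms'[OF deg] unfolding shifted_coeff_def by simp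
  finally show ?thesis
    by (simp add: pcompose_sum mono)
qed

lemma poly_shifted_expansion:
  assumes "degree P \<le> n"
  shows "poly P z = (\<Sum>j\<le>n. shifted_coeff z0 P j * (z - z0) ^ j)"
  by (subst shifted_expansion[OF assms, of z0]) (simp add: poly_sum poly_power algebra_simps)

lemma shifted_coeff_power_sum:
  assumes "j \<le> n"
  shows "shifted_coeff z0 (\<Sum>i\<le>n. smult (q i) ([:- z0, 1:] ^ i)) j = q j"
proof -
  have "pcompose ([:- z0, 1:] ^ i) [:z0, 1:] = monom 1 i" for i
    by (simp add: pcompose_power pcompose_pCons monom_altdef)
  then show ?thesis
    using assms by (simp add: shifted_coeff_def pcompose_sum pcompose_smult coeff_sum smult_monom if_distrib cong: if_cong)
qed

lemma normalized_polys_iff: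
  "P \<in> normalized_polys N z0 \<longleftrightarrow> degree P \<le> N \<and> (\<Sum>j\<le>N. (cmod (shifted_coeff z0 P j))\<^sup>2) = 1"
proof
  assume "P \<in> normalized_polys N z0"
  then obtain q where P: "P = (\<Sum>j\<le>N. smult (q j) ([:- z0, 1:] ^ j))" and q: "(\<Sum>j\<le>N. (cmod (q j))\<^sup>2) = 1"
    unfolding normalized_polys_def by blast
  have "degree P \<le> N"
    unfolding P by (intro degree_sum_le) (auto intro!: order.trans[OF degree_smult_le] simp: degree_linear_power)
  then show "degree P \<le> N \<and> (\<Sum>j\<le>N. (cmod (shifted_coeff z0 P j))\<^sup>2) = 1"
    using q unfolding P by (simp add: shifted_coeff_power_sum)
next
  assume "degree P \<le> N \<and> (\<Sum>j\<le>N. (cmod (shifted_coeff z0 P j))\<^sup>2) = 1"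
  then show "P \<in> normalized_polys N z0"
    unfolding normalized_polys_def using shifted_expansion[of P N z0] by blast
qed

lemma normalized_coeff_le_1:
  assumes "P \<in> normalized_polys N z0" "j \<le> N"
  shows "cmod (shifted_coeff z0 P j) \<le> 1"
proof -
  have "(cmod (shifted_coeff z0 P j))\<^sup>2 \<le> (\<Sum>j\<le>N. (cmod (shifted_coeff z0 P j))\<^sup>2)"
    using assms(2) by (intro member_le_sum) auto
  then have "(cmod (shifted_coeff z0 P j))\<^sup>2 \<le> 1\<^sup>2"
    using assms(1) by (simp add: normalized_polys_iff)
  then show ?thesis
    by (rule power2_le_imp_le) simp
qed

text \<open>The coefficients of the poles at distance at least \<open>\<rho>\<close> in the \<open>n\<close>-th Taylor coefficient are at
  most \<open>growth z0 \<rho> P / \<rho>\<^sup>n\<close>; the point is that the constant is independent of \<open>n\<close>.\<close>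

definition growth :: "complex \<Rightarrow> real \<Rightarrow> complex poly \<Rightarrow> real"
  where "growth z0 \<rho> P = (\<Sum>j\<le>degree P. cmod (shifted_coeff z0 P j) * \<rho> ^ j / \<rho>)"

lemma growth_bound:
  assumes "degree P \<le> n" "0 < \<rho>" "\<rho> \<le> cmod (z - z0)"
  shows "cmod (poly P z / (z - z0) ^ Suc n) \<le> growth z0 \<rho> P / \<rho> ^ n"
proof -
  have pos: "0 < cmod (z - z0)" using assms by linarith
  have "cmod (poly P z) \<le> (\<Sum>j\<le>degree P. cmod (shifted_coeff z0 P j) * cmod (z - z0) ^ j)"
    unfolding poly_shifted_expansion[of P "degree P" z z0, OF order_refl]
    by (rule order.trans[OF norm_sum]) (simp add: norm_mult norm_power)
  then have "cmod (poly P z / (z - z0) ^ Suc n)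
      \<le> (\<Sum>j\<le>degree P. cmod (shifted_coeff z0 P j) * cmod (z - z0) ^ j) / cmod (z - z0) ^ Suc n"
    using pos by (simp add: norm_divide norm_power norm_mult divide_right_mono del: power_Suc)
  also have "\<dots> = (\<Sum>j\<le>degree P. cmod (shifted_coeff z0 P j) * (cmod (z - z0) ^ j / cmod (z - z0) ^ Suc n))"
    by (simp add: sum_divide_distrib)
  also have "\<dots> \<le> (\<Sum>j\<le>degree P. cmod (shifted_coeff z0 P j) * (\<rho> ^ j / \<rho> ^ Suc n))"
  proof (intro sum_mono mult_left_mono)
    fix j assume "j \<in> {..degree P}"
    then have j: "Suc n = j + (Suc n - j)" using assms(1) by auto
    have "x ^ j / x ^ Suc n = 1 / x ^ (Suc n - j)" if "0 < x" for x :: real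
      by (subst j) (use that in \<open>simp add: power_add\<close>)
    then show "cmod (z - z0) ^ j / cmod (z - z0) ^ Suc n \<le> \<rho> ^ j / \<rho> ^ Suc n"
      using pos assms(2,3) by (simp only:) (intro divide_left_mono power_mono mult_pos_pos zero_less_power; simp)
  qed auto
  also have "\<dots> = growth z0 \<rho> P / \<rho> ^ n"
    unfolding growth_def by (simp add: sum_divide_distrib)
  finally show ?thesis .
qed

lemma growth_nonneg: "0 < \<rho> \<Longrightarrow> 0 \<le> growth z0 \<rho> P"
  unfolding growth_def by (intro sum_nonneg) auto

text \<open>If all roots are at distance at least \<open>m\<close> from \<open>z\<close>, the logarithmic derivative \<open>Q' / Q\<close> at \<open>z\<close> is
  a sum of \<open>degree Q\<close> terms \<open>1 / (z - r)\<close>, each at most \<open>1 / m\<close> in modulus. So a small value and a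
  derivative bounded below force a nearby root. Induction on the degree proves it without division.\<close>

lemma root_distance:
  fixes Q :: "complex poly"
  assumes "0 \<le> m" and "\<And>r. poly Q r = 0 \<Longrightarrow> m \<le> cmod (z - r)"
  shows "m * cmod (poly (pderiv Q) z) \<le> degree Q * cmod (poly Q z)"
  using assms(2)
proof (induction "degree Q" arbitrary: Q)
  case 0
  then have "pderiv Q = 0" by (simp add: pderiv_eq_0_iff)
  then show ?case by simp
next
  case (Suc n)
  have "\<not> constant (poly Q)"
    using Suc.hyps(2) by (simp add: constant_degree)
  from Fundamental_Theorem_Algebra.fundamental_theorem_of_algebra[OF this] obtain r where r: "poly Q r = 0" ..
  then obtain P where Q: "Q = [:- r, 1:] * P"
    unfolding poly_eq_0_iff_dvd by (rule dvdE)
  have "P \<noteq> 0" using Suc.hyps(2) Q by auto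
  then have deg: "degree Q = Suc (degree P)"
    unfolding Q by (subst degree_mult_eq) auto
  have norm_Q: "cmod (poly Q z) = cmod (z - r) * cmod (poly P z)"
    unfolding Q by (simp only: poly_mult norm_mult) simp
  have IH: "m * cmod (poly (pderiv P) z) \<le> degree P * cmod (poly P z)"
    by (rule Suc.hyps(1)) (use Suc deg Q in auto)
  have "poly (pderiv Q) z = poly P z + (z - r) * poly (pderiv P) z"
    unfolding Q by (simp only: pderiv_mult) (simp add: pderiv_pCons algebra_simps)
  then have "m * cmod (poly (pderiv Q) z) \<le> m * (cmod (poly P z) + cmod (z - r) * cmod (poly (pderiv P) z))"
    using assms(1) by (metis mult_left_mono norm_mult norm_triangle_ineq)
  also have "\<dots> = m * cmod (poly P z) + cmod (z - r) * (m * cmod (poly (pderiv P) z))"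
    by (simp add: algebra_simps)
  also have "\<dots> \<le> cmod (z - r) * cmod (poly P z) + cmod (z - r) * (degree P * cmod (poly P z))"
    by (intro add_mono mult_right_mono mult_left_mono IH Suc.prems r) auto
  also have "\<dots> = degree Q * cmod (poly Q z)"
    unfolding deg norm_Q by (simp add: algebra_simps)
  finally show ?case .
qed

section \<open>Nodal polynomials and Lagrange interpolation\<close>

definition nodal :: "(nat \<Rightarrow> complex) \<Rightarrow> nat set \<Rightarrow> complex poly"
  where "nodal mu A = (\<Prod>k\<in>A. [:- mu k, 1:])"

lemma poly_nodal: "poly (nodal mu A) z = (\<Prod>k\<in>A. z - mu k)"
  unfolding nodal_def by (simp add: poly_prod)

lemma degree_nodal: "degree (nodal mu A) = card A"
  unfolding nodal_def by (subst degree_prod_eq_sum_degree) auto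

lemma lead_coeff_nodal: "lead_coeff (nodal mu A) = 1"
  unfolding nodal_def lead_coeff_prod by simp

lemma poly_nodal_eq_0_iff: "finite A \<Longrightarrow> poly (nodal mu A) z = 0 \<longleftrightarrow> z \<in> mu ` A"
  by (auto simp: poly_nodal)

lemma poly_pderiv_nodal:
  assumes "finite A" "a \<in> A"
  shows "poly (pderiv (nodal mu A)) (mu a) = poly (nodal mu (A - {a})) (mu a)"
proof -
  have "nodal mu A = [:- mu a, 1:] * nodal mu (A - {a})"
    unfolding nodal_def using assms by (rule prod.remove)
  then show ?thesis
    by (simp only: pderiv_mult) (simp add: pderiv_pCons)
qed

text \<open>There is one node fewer than a polynomial of degree \<open>N\<close> needs, so the leading coefficient enters
  as an additional datum.\<close>

lemma Lagrange_interpolation: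
  assumes inj: "inj_on mu {..<N}" and deg: "degree Q \<le> N"
  shows "Q = smult (coeff Q N) (nodal mu {..<N}) +
    (\<Sum>a<N. smult (poly Q (mu a) / poly (nodal mu ({..<N} - {a})) (mu a)) (nodal mu ({..<N} - {a})))"
    (is "Q = ?W + ?S")
proof (rule poly_eqI_degree_lead_coeff[where n = N and A = "mu ` {..<N}"])
  have degS: "degree (nodal mu ({..<N} - {a})) < N" if "a < N" for a
    using that by (simp add: degree_nodal card_Diff_singleton)
  have "coeff ?S N = 0"
    unfolding coeff_sum using degS by (intro sum.neutral ballI) (simp add: coeff_eq_0)
  moreover have "coeff (nodal mu {..<N}) N = 1"
    using lead_coeff_nodal[of mu "{..<N}"] by (simp add: degree_nodal)
  ultimately show "coeff Q N = coeff (?W + ?S) N"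
    by simp
  have "degree ?W \<le> N"
    by (rule order.trans[OF degree_smult_le]) (simp add: degree_nodal)
  moreover have "degree ?S \<le> N"
    using degS by (intro degree_sum_le) (auto intro!: order.trans[OF degree_smult_le] less_imp_le)
  ultimately show "degree (?W + ?S) \<le> N"
    by (rule degree_add_le)
  show "N \<le> card (mu ` {..<N})"
    using inj by (simp add: card_image)
  show "poly Q z = poly (?W + ?S) z" if z: "z \<in> mu ` {..<N}" for z
  proof -
    obtain b where b: "b < N" "z = mu b" using z by auto
    have zero: "poly (nodal mu ({..<N} - {a})) (mu b) = 0" if "a < N" "a \<noteq> b" for a
      using that b by (auto simp: poly_nodal_eq_0_iff)
    have nz: "poly (nodal mu ({..<N} - {b})) (mu b) \<noteq> 0"
      using b inj by (auto simp: poly_nodal_eq_0_iff inj_on_def)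
    have "poly ?S z = (\<Sum>a\<in>{b}. poly Q (mu a) / poly (nodal mu ({..<N} - {a})) (mu a) * poly (nodal mu ({..<N} - {a})) z)"
      unfolding poly_sum poly_smult b(2)
      by (rule sum.mono_neutral_right) (use b zero in auto)
    then have "poly ?S z = poly Q z"
      using nz b by simp
    moreover have "poly ?W z = 0"
      using z by (simp add: poly_nodal_eq_0_iff)
    ultimately show ?thesis by simp
  qed
qed (rule deg)

section \<open>Taylor coefficients of a pole expansion\<close>

text \<open>The data that remain of the operator: the orthogonal residues \<open>v k\<close> of the solution map (up to
  sign) and its poles \<open>mu k\<close>, by increasing distance from the centre.\<close>

locale pole_expansion = square_summable_orthogonal_series v for v :: "nat \<Rightarrow> 'v::complex_hilbert_space" +
  fixes mu :: "nat \<Rightarrow> complex" and z0 :: complex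
  assumes v_nonzero: "v k \<noteq> 0"
    and inj_mu: "inj mu"
    and mu_neq: "mu k \<noteq> z0"
    and ordered: "j \<le> k \<Longrightarrow> cmod (mu j - z0) \<le> cmod (mu k - z0)"
begin

text \<open>The \<open>n\<close>-th Taylor coefficient at \<open>z0\<close> of the product of \<open>P\<close> with the pole expansion, as proved
  below for polynomials of degree at most \<open>n\<close>. It is linear in \<open>P\<close>.\<close>

definition tau :: "nat \<Rightarrow> complex poly \<Rightarrow> 'v"
  where "tau n P = (\<Sum>k. (poly P (mu k) / (mu k - z0) ^ Suc n) *\<^sub>C v k)"

lemma coeff_bound:
  assumes "degree P \<le> n"
  shows "cmod (poly P (mu k) / (mu k - z0) ^ Suc n) \<le> growth z0 (cmod (mu 0 - z0)) P / cmod (mu 0 - z0) ^ n"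
  using mu_neq[of 0] by (intro growth_bound assms ordered) auto

lemma tau_add: "degree P \<le> n \<Longrightarrow> degree R \<le> n \<Longrightarrow> tau n (P + R) = tau n P + tau n R"
  unfolding tau_def
  by (subst suminf_add) (auto intro!: summable_scaleC coeff_bound simp: add_divide_distrib scaleC_add_left simp del: power_Suc)

lemma tau_smult:
  assumes "degree P \<le> n"
  shows "tau n (smult a P) = a *\<^sub>C tau n P"
  unfolding tau_def
    bounded_linear.suminf[OF scaleC.bounded_linear_right summable_scaleC[OF coeff_bound[OF assms]]]
  by simp

lemma cinner_tau:
  "degree P \<le> n \<Longrightarrow> cinner (tau n P) (v j) = poly P (mu j) / (mu j - z0) ^ Suc n * complex_of_real ((norm (v j))\<^sup>2)"
  unfolding tau_def by (rule cinner_suminf[OF coeff_bound])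

lemma tau_tail:
  assumes deg: "degree P \<le> n" and "0 < \<rho>" and far: "\<And>k. N \<le> k \<Longrightarrow> \<rho> \<le> cmod (mu k - z0)"
  shows "norm (tau n P - (\<Sum>k<N. (poly P (mu k) / (mu k - z0) ^ Suc n) *\<^sub>C v k)) \<le> growth z0 \<rho> P / \<rho> ^ n * l2_norm"
proof -
  let ?c = "\<lambda>k. poly P (mu k) / (mu k - z0) ^ Suc n"
  define c' where "c' k = (if k < N then 0 else ?c k)" for k
  have fin: "(\<lambda>k. if k < N then ?c k *\<^sub>C v k else 0) sums (\<Sum>k<N. ?c k *\<^sub>C v k)"
    using sums_If_finite_set[of "{..<N}" "\<lambda>k. ?c k *\<^sub>C v k"] by (simp only: finite_lessThan lessThan_iff)
  have "(\<lambda>k. ?c k *\<^sub>C v k) sums tau n P"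
    unfolding tau_def by (intro summable_sums summable_scaleC[OF coeff_bound[OF deg]])
  from sums_diff[OF this fin]
  have "(\<lambda>k. c' k *\<^sub>C v k) sums (tau n P - (\<Sum>k<N. ?c k *\<^sub>C v k))"
    by (rule sums_cong[THEN iffD1, rotated]) (auto simp: c'_def)
  then have eq: "tau n P - (\<Sum>k<N. ?c k *\<^sub>C v k) = (\<Sum>k. c' k *\<^sub>C v k)"
    by (rule sums_unique)
  have "cmod (c' k) \<le> growth z0 \<rho> P / \<rho> ^ n" for k
  proof (cases "k < N")
    case True
    then show ?thesis
      using growth_nonneg[OF \<open>0 < \<rho>\<close>, of z0 P] \<open>0 < \<rho>\<close> by (simp add: c'_def)
  next
    case False
    then show ?thesis
      unfolding c'_def using growth_bound[OF deg \<open>0 < \<rho>\<close> far[of k]] by (simp del: power_Suc)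
  qed
  then show ?thesis
    unfolding eq by (rule norm_suminf_le)
qed

lemma taylor_coeff_eq_tau:
  assumes deg: "degree P \<le> n"
    and S: "\<And>z. z \<in> ball z0 (cmod (mu 0 - z0) / 2) \<Longrightarrow> S z = (\<Sum>k. (1 / (mu k - z)) *\<^sub>C v k)"
  shows "taylor_coeff (\<lambda>z. poly P z *\<^sub>C S z) n z0 = tau n P"
proof -
  define r where "r = cmod (mu 0 - z0) / 2"
  have r: "0 < r" unfolding r_def using mu_neq[of 0] by simp
  have away: "r \<le> cmod (mu k - z)" if "z \<in> ball z0 r" for k z
  proof -
    have "2 * r \<le> cmod (mu k - z0)" using ordered[of 0 k] unfolding r_def by simp
    also have "\<dots> \<le> cmod (mu k - z) + cmod (z - z0)"
      using norm_triangle_ineq[of "mu k - z" "z - z0"] by simp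
    finally show ?thesis using that by (simp add: dist_norm norm_minus_commute)
  qed
  have nz: "mu k - z \<noteq> 0" if "z \<in> ball z0 r" for k z
    using away[OF that, of k] r by auto
  have "bounded (poly P ` cball z0 r)"
    by (intro compact_imp_bounded compact_continuous_image continuous_intros compact_cball)
  then obtain B where B: "\<forall>y\<in>poly P ` cball z0 r. cmod y \<le> B"
    unfolding bounded_iff by blast
  have B': "cmod (poly P z) \<le> B" if "z \<in> ball z0 r" for z
    using B that by auto
  have b: "cmod (1 / (mu k - z)) \<le> 1 / r" if "z \<in> ball z0 r" for k z
    using away[OF that, of k] r by (simp add: norm_divide frac_le)
  have "(vderiv ^^ n) (\<lambda>z. poly P z *\<^sub>C S z) z0 = (\<Sum>k. (deriv ^^ n) (\<lambda>z. poly P z / (mu k - z)) z0 *\<^sub>C v k)"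
  proof (rule vderiv_funpow_suminf)
    show "(\<lambda>z. poly P z / (mu k - z)) holomorphic_on ball z0 r" for k
      using nz by (intro holomorphic_intros) auto
    show "cmod (poly P z / (mu k - z)) \<le> B / r" if "z \<in> ball z0 r" for k z
      using away[OF that, of k] r B'[OF that] order_trans[OF norm_ge_zero B'[OF that]]
      unfolding norm_divide by (intro frac_le) auto
    show "poly P z *\<^sub>C S z = (\<Sum>k. (poly P z / (mu k - z)) *\<^sub>C v k)" if "z \<in> ball z0 r" for z
      unfolding S[OF that[unfolded r_def]]
        bounded_linear.suminf[OF scaleC.bounded_linear_right summable_scaleC[OF b[OF that]]]
      by simp
  qed (use r in auto)
  also have "\<dots> = (\<Sum>k. fact n *\<^sub>C (poly P (mu k) / (mu k - z0) ^ Suc n) *\<^sub>C v k)"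
    by (simp only: higher_deriv_poly_over_linear[OF deg mu_neq[symmetric]] scaleC_scaleC)
  also have "\<dots> = fact n *\<^sub>C tau n P"
    unfolding tau_def
    by (rule bounded_linear.suminf[OF scaleC.bounded_linear_right summable_scaleC[OF coeff_bound[OF deg]], symmetric])
  finally show ?thesis
    unfolding taylor_coeff_def by simp
qed

section \<open>Minimizers of the functional\<close>

text \<open>The Euler-Lagrange equation of a minimizer: \<open>Q\<close> is an eigenvector, for the smallest eigenvalue, of
  the Gram form \<open>(P, R) \<mapsto> cinner (tau n P) (tau n R)\<close>. It holds because the form minus the
  eigenvalue times the coefficient inner product is positive semidefinite and vanishes at \<open>Q\<close>.\<close>

lemma minimizer_stationary:
  assumes "N \<le> n" and deg: "degree Q \<le> N" "degree R \<le> N"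
    and norm_Q: "(\<Sum>j\<le>N. (cmod (shifted_coeff z0 Q j))\<^sup>2) = 1"
    and minimal: "\<And>P. P \<in> normalized_polys N z0 \<Longrightarrow> norm (tau n Q) \<le> norm (tau n P)"
  shows "cinner (tau n Q) (tau n R) =
    complex_of_real ((norm (tau n Q))\<^sup>2) * (\<Sum>j\<le>N. shifted_coeff z0 Q j * cnj (shifted_coeff z0 R j))"
proof -
  define \<sigma> where "\<sigma> = norm (tau n Q)"
  define nrm where "nrm P = (\<Sum>j\<le>N. (cmod (shifted_coeff z0 P j))\<^sup>2)" for P
  have nrm_nonneg: "0 \<le> nrm P" for P unfolding nrm_def by (simp add: sum_nonneg)
  define ip where "ip = (\<Sum>j\<le>N. shifted_coeff z0 Q j * cnj (shifted_coeff z0 R j))"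
  \<comment> \<open>Minimality on the unit sphere, made homogeneous.\<close>
  have lower: "\<sigma>\<^sup>2 * nrm P \<le> (norm (tau n P))\<^sup>2" if P: "degree P \<le> N" for P
  proof (cases "nrm P = 0")
    case False
    then have pos: "0 < nrm P" using nrm_nonneg[of P] by simp
    define a where "a = complex_of_real (1 / sqrt (nrm P))"
    have a: "(cmod a)\<^sup>2 = 1 / nrm P"
      unfolding a_def norm_of_real using pos by (simp add: power_divide)
    have "nrm (smult a P) = (cmod a)\<^sup>2 * nrm P"
      unfolding nrm_def by (simp add: shifted_coeff_smult norm_mult power_mult_distrib sum_distrib_left)
    then have "smult a P \<in> normalized_polys N z0"
      unfolding normalized_polys_iff using P pos a degree_smult_le[of a P] by (simp add: nrm_def)
    from minimal[OF this] have "\<sigma> \<le> cmod a * norm (tau n P)"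
      unfolding \<sigma>_def using P \<open>N \<le> n\<close> by (simp add: tau_smult norm_scaleC)
    then have "\<sigma>\<^sup>2 \<le> (cmod a * norm (tau n P))\<^sup>2"
      by (intro power_mono) (auto simp: \<sigma>_def)
    then show ?thesis
      using pos by (simp add: power_mult_distrib a field_simps)
  qed simp
  have "cinner (tau n Q) (tau n R) - complex_of_real (\<sigma>\<^sup>2) * ip = 0"
  proof (rule zero_if_quadratic_nonneg)
    fix t
    have deg': "degree (Q + smult t R) \<le> N"
      by (intro degree_add_le deg order.trans[OF degree_smult_le])
    have degn: "degree Q \<le> n" "degree R \<le> n" "degree (smult t R) \<le> n"
      using deg \<open>N \<le> n\<close> degree_smult_le[of t R] by linarith+
    have "nrm (Q + smult t R) =
        (\<Sum>j\<le>N. (cmod (shifted_coeff z0 Q j))\<^sup>2 + 2 * Re (cnj t * (shifted_coeff z0 Q j * cnj (shifted_coeff z0 R j)))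
          + (cmod t)\<^sup>2 * (cmod (shifted_coeff z0 R j))\<^sup>2)"
      unfolding nrm_def shifted_coeff_add shifted_coeff_smult
      by (intro sum.cong refl norm_add_scaleC_square[where 'v = complex, unfolded scaleC_complex_def cinner_complex_def])
    also have "\<dots> = 1 + 2 * Re (cnj t * ip) + (cmod t)\<^sup>2 * nrm R"
      unfolding sum.distrib norm_Q ip_def nrm_def
      by (simp only: sum_distrib_left[symmetric] Re_sum[symmetric])
    finally have nrm: "nrm (Q + smult t R) = 1 + 2 * Re (cnj t * ip) + (cmod t)\<^sup>2 * nrm R" .
    have "(norm (tau n (Q + smult t R)))\<^sup>2 =
        \<sigma>\<^sup>2 + 2 * Re (cnj t * cinner (tau n Q) (tau n R)) + (cmod t)\<^sup>2 * (norm (tau n R))\<^sup>2"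
      unfolding tau_add[OF degn(1,3)] tau_smult[OF degn(2)] \<sigma>_def by (rule norm_add_scaleC_square)
    with lower[OF deg']
    have "0 \<le> 2 * (Re (cnj t * cinner (tau n Q) (tau n R)) - \<sigma>\<^sup>2 * Re (cnj t * ip))
        + (cmod t)\<^sup>2 * ((norm (tau n R))\<^sup>2 - \<sigma>\<^sup>2 * nrm R)"
      unfolding nrm by (simp add: algebra_simps)
    also have "Re (cnj t * cinner (tau n Q) (tau n R)) - \<sigma>\<^sup>2 * Re (cnj t * ip)
        = Re (cnj t * (cinner (tau n Q) (tau n R) - complex_of_real (\<sigma>\<^sup>2) * ip))"
      by (simp add: algebra_simps del: of_real_power)
    finally show "0 \<le> 2 * Re (cnj t * (cinner (tau n Q) (tau n R) - complex_of_real (\<sigma>\<^sup>2) * ip))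
        + (cmod t)\<^sup>2 * ((norm (tau n R))\<^sup>2 - \<sigma>\<^sup>2 * nrm R)" .
  qed
  then show ?thesis
    unfolding \<sigma>_def ip_def by simp
qed


text \<open>With \<open>\<rho> = \<bar>mu N - z0\<bar>\<close>, the bound \<open>\<parallel>tau n (Q n)\<parallel> = O(\<rho>\<^sup>-\<^sup>n)\<close> alone would give only the exponent \<open>n\<close>, through the component
  along \<open>v a\<close>. Stationarity doubles it: the pairing of \<open>tau n (Q n)\<close> with \<open>tau n R\<close>, for the nodal
  polynomial \<open>R\<close> of the other poles, equals the squared minimum times a bounded factor, and differs
  from a fixed multiple of \<open>Q(mu a) / \<bar>mu a - z0\<bar>\<^sup>2\<^sup>n\<close> by a pairing of two vectors of size \<open>O(\<rho>\<^sup>-\<^sup>n)\<close>.\<close>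

lemma minimizer_at_pole:
  assumes N: "a < N"
    and Q: "\<And>n. N \<le> n \<Longrightarrow> Q n \<in> normalized_polys N z0"
    and minimal: "\<And>n P. N \<le> n \<Longrightarrow> P \<in> normalized_polys N z0 \<Longrightarrow> norm (tau n (Q n)) \<le> norm (tau n P)"
  shows "\<exists>K. \<forall>n\<ge>N. cmod (poly (Q n) (mu a)) \<le> K * (cmod (mu a - z0) / cmod (mu N - z0)) ^ (2 * n)"
proof -
  define \<rho> where "\<rho> = cmod (mu N - z0)"
  define \<delta> where "\<delta> = cmod (mu a - z0)"
  have pos: "0 < \<rho>" "0 < \<delta>" unfolding \<rho>_def \<delta>_def using mu_neq by simp_all
  have far: "\<rho> \<le> cmod (mu k - z0)" if "N \<le> k" for k
    unfolding \<rho>_def using ordered that .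
  have degQ: "degree (Q n) \<le> N" and normQ: "(\<Sum>j\<le>N. (cmod (shifted_coeff z0 (Q n) j))\<^sup>2) = 1" if "N \<le> n" for n
    using Q[OF that] unfolding normalized_polys_iff by auto
  \<comment> \<open>The minimum is at most the value at the normalised nodal polynomial of the first \<open>N\<close> poles,
      which sees only the poles at distance at least \<open>\<rho>\<close>.\<close>
  define W where "W = nodal mu {..<N}"
  define nrm where "nrm = (\<Sum>j\<le>N. (cmod (shifted_coeff z0 W j))\<^sup>2)"
  have "W \<noteq> 0" using lead_coeff_nodal[of mu "{..<N}"] unfolding W_def by auto
  have degW: "degree W = N" unfolding W_def by (simp add: degree_nodal)
  have "nrm \<noteq> 0"
  proof
    assume "nrm = 0"
    then have "shifted_coeff z0 W j = 0" if "j \<le> N" for j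
      using that unfolding nrm_def by (subst (asm) sum_nonneg_eq_0_iff) auto
    then have "W = 0"
      by (subst shifted_expansion[of W N z0]) (auto simp: degW)
    then show False using \<open>W \<noteq> 0\<close> by blast
  qed
  then have nrm: "0 < nrm"
    unfolding nrm_def by (simp add: order_less_le sum_nonneg)
  define b where "b = complex_of_real (1 / sqrt nrm)"
  have b: "(cmod b)\<^sup>2 = 1 / nrm"
    unfolding b_def norm_of_real using nrm by (simp add: power_divide)
  define W1 where "W1 = smult b W"
  have degW1: "degree W1 \<le> N"
    unfolding W1_def using degW degree_smult_le[of b W] by simp
  have "(\<Sum>j\<le>N. (cmod (shifted_coeff z0 W1 j))\<^sup>2) = (cmod b)\<^sup>2 * nrm"
    unfolding nrm_def W1_def by (simp add: shifted_coeff_smult norm_mult power_mult_distrib sum_distrib_left)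
  then have W1: "W1 \<in> normalized_polys N z0"
    unfolding normalized_polys_iff using degW1 b nrm by simp
  have W1_zero: "poly W1 (mu k) = 0" if "k < N" for k
    unfolding W1_def W_def using that by (simp add: poly_nodal_eq_0_iff)
  define C1 where "C1 = growth z0 \<rho> W1 * l2_norm"
  have C1: "norm (tau n (Q n)) \<le> C1 / \<rho> ^ n" if n: "N \<le> n" for n
  proof -
    have "norm (tau n (Q n)) \<le> norm (tau n W1)"
      by (rule minimal[OF n W1])
    also have "\<dots> \<le> growth z0 \<rho> W1 / \<rho> ^ n * l2_norm"
      using tau_tail[of W1 n \<rho> N] degW1 n pos far W1_zero by simp
    finally show ?thesis unfolding C1_def by simp
  qed
  \<comment> \<open>\<open>R\<close> vanishes at all of the first \<open>N\<close> poles except \<open>mu a\<close>, so pairing with it isolates the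
      value of \<open>Q n\<close> at \<open>mu a\<close> up to a tail.\<close>
  define R where "R = nodal mu ({..<N} - {a})"
  have degR: "degree R \<le> N"
    unfolding R_def by (simp add: degree_nodal card_Diff_subset_Int)
  have R_zero: "poly R (mu k) = 0" if "k < N" "k \<noteq> a" for k
    unfolding R_def using that by (simp add: poly_nodal_eq_0_iff)
  have R_nz: "poly R (mu a) \<noteq> 0"
    unfolding R_def using inj_mu by (auto simp: poly_nodal_eq_0_iff inj_eq)
  define C2 where "C2 = growth z0 \<rho> R * l2_norm"
  have C2: "norm (tau n R - (poly R (mu a) / (mu a - z0) ^ Suc n) *\<^sub>C v a) \<le> C2 / \<rho> ^ n" if n: "N \<le> n" for n
  proof -
    have "(\<Sum>k<N. (poly R (mu k) / (mu k - z0) ^ Suc n) *\<^sub>C v k)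
        = (\<Sum>k\<in>{a}. (poly R (mu k) / (mu k - z0) ^ Suc n) *\<^sub>C v k)"
      by (rule sum.mono_neutral_right) (use N R_zero in auto)
    then show ?thesis
      using tau_tail[of R n \<rho> N] degR n pos far unfolding C2_def by simp
  qed
  define D where "D = (\<Sum>j\<le>N. cmod (shifted_coeff z0 R j))"
  have D: "cmod (\<Sum>j\<le>N. shifted_coeff z0 (Q n) j * cnj (shifted_coeff z0 R j)) \<le> D" if n: "N \<le> n" for n
    unfolding D_def
  proof (rule order.trans[OF norm_sum], rule sum_mono)
    fix j assume j: "j \<in> {..N}"
    have "cmod (shifted_coeff z0 (Q n) j) \<le> 1"
      using Q[OF n] j by (intro normalized_coeff_le_1) auto
    then show "cmod (shifted_coeff z0 (Q n) j * cnj (shifted_coeff z0 R j)) \<le> cmod (shifted_coeff z0 R j)"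
      by (simp add: norm_mult mult_left_le_one_le)
  qed
  define w where "w = cmod (poly R (mu a)) * (norm (v a))\<^sup>2"
  have w: "0 < w" unfolding w_def using R_nz v_nonzero by simp
  define K where "K = (C1\<^sup>2 * D + C1 * C2) * \<delta>\<^sup>2 / w"
  have "cmod (poly (Q n) (mu a)) \<le> K * (\<delta> / \<rho>) ^ (2 * n)" if n: "N \<le> n" for n
  proof -
    define q where "q = poly (Q n) (mu a)"
    define y where "y = tau n R - (poly R (mu a) / (mu a - z0) ^ Suc n) *\<^sub>C v a"
    define \<sigma> where "\<sigma> = norm (tau n (Q n))"
    define ip where "ip = (\<Sum>j\<le>N. shifted_coeff z0 (Q n) j * cnj (shifted_coeff z0 R j))"
    have \<sigma>: "0 \<le> \<sigma>" "\<sigma> \<le> C1 / \<rho> ^ n"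
      unfolding \<sigma>_def using C1[OF n] by auto
    have stat: "cinner (tau n (Q n)) (tau n R) = complex_of_real (\<sigma>\<^sup>2) * ip"
      unfolding \<sigma>_def ip_def using n by (intro minimizer_stationary degQ degR normQ minimal)
    have "cinner (tau n (Q n)) (tau n R - y) = cnj (poly R (mu a) / (mu a - z0) ^ Suc n) *
        (q / (mu a - z0) ^ Suc n * complex_of_real ((norm (v a))\<^sup>2))"
      unfolding y_def q_def using degQ[OF n] n by (simp add: cinner_scaleC_right cinner_tau del: power_Suc)
    then have "cmod (cinner (tau n (Q n)) (tau n R - y)) = cmod q * w / (\<delta> ^ Suc n * \<delta> ^ Suc n)"
      unfolding w_def \<delta>_def by (simp add: norm_mult norm_divide norm_power del: power_Suc complex_cnj_diff)
    also have "\<delta> ^ Suc n * \<delta> ^ Suc n = \<delta>\<^sup>2 * \<delta> ^ (2 * n)"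
      by (simp add: power_mult power2_eq_square power_mult_distrib)
    finally have lhs: "cmod (cinner (tau n (Q n)) (tau n R - y)) = cmod q * w / (\<delta>\<^sup>2 * \<delta> ^ (2 * n))" .
    have "cinner (tau n (Q n)) (tau n R - y) = complex_of_real (\<sigma>\<^sup>2) * ip - cinner (tau n (Q n)) y"
      unfolding cinner.diff_right stat ..
    then have "cmod (cinner (tau n (Q n)) (tau n R - y)) \<le> \<sigma>\<^sup>2 * cmod ip + cmod (cinner (tau n (Q n)) y)"
      using norm_triangle_ineq4[of "complex_of_real (\<sigma>\<^sup>2) * ip" "cinner (tau n (Q n)) y"]
      by (simp add: norm_mult norm_power)
    also have "\<dots> \<le> (C1 / \<rho> ^ n)\<^sup>2 * D + C1 / \<rho> ^ n * (C2 / \<rho> ^ n)"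
    proof (rule add_mono)
      show "\<sigma>\<^sup>2 * cmod ip \<le> (C1 / \<rho> ^ n)\<^sup>2 * D"
        unfolding ip_def by (intro mult_mono power_mono \<sigma> D n) auto
      have "cmod (cinner (tau n (Q n)) y) \<le> \<sigma> * norm y"
        unfolding \<sigma>_def by (rule Cauchy_Schwarz)
      also have "\<dots> \<le> C1 / \<rho> ^ n * (C2 / \<rho> ^ n)"
        using \<sigma> C2[OF n] unfolding y_def by (intro mult_mono) auto
      finally show "cmod (cinner (tau n (Q n)) y) \<le> C1 / \<rho> ^ n * (C2 / \<rho> ^ n)" .
    qed
    also have "\<dots> = (C1\<^sup>2 * D + C1 * C2) / \<rho> ^ (2 * n)"
      using pos by (simp add: power_divide power_mult power2_eq_square power_mult_distrib add_divide_distrib)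
    finally have "cmod q * w / (\<delta>\<^sup>2 * \<delta> ^ (2 * n)) \<le> (C1\<^sup>2 * D + C1 * C2) / \<rho> ^ (2 * n)"
      unfolding lhs .
    then have "cmod q * w \<le> (C1\<^sup>2 * D + C1 * C2) / \<rho> ^ (2 * n) * (\<delta>\<^sup>2 * \<delta> ^ (2 * n))"
      using pos by (subst (asm) pos_divide_le_eq) auto
    then have "cmod q \<le> (C1\<^sup>2 * D + C1 * C2) / \<rho> ^ (2 * n) * (\<delta>\<^sup>2 * \<delta> ^ (2 * n)) / w"
      by (simp only: pos_le_divide_eq[OF w])
    then show ?thesis
      unfolding q_def K_def by (simp add: power_divide mult_ac)
  qed
  then show ?thesis
    unfolding \<rho>_def \<delta>_def by blast
qed

section \<open>Convergence of the roots\<close>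

text \<open>By interpolation the minimizers approach multiples of the nodal polynomial of the first \<open>N\<close> poles,
  normalised and hence not tending to zero. So the degree is eventually \<open>N\<close>, the derivative at the
  simple root \<open>mu a\<close> stays away from zero, and the distance from \<open>mu a\<close> to the nearest root is
  comparable to the value at \<open>mu a\<close>.\<close>

lemma minimizer_roots:
  assumes N: "a < N" and gap: "cmod (mu (N - 1) - z0) < cmod (mu N - z0)"
    and Q: "\<And>n. N \<le> n \<Longrightarrow> Q n \<in> normalized_polys N z0"
    and minimal: "\<And>n P. N \<le> n \<Longrightarrow> P \<in> normalized_polys N z0 \<Longrightarrow> norm (tau n (Q n)) \<le> norm (tau n P)"
  shows "\<exists>c. \<forall>\<^sub>F n in sequentially. size (proots (Q n)) = N \<and>
    Min ((\<lambda>r. cmod (r - mu a)) ` set_mset (proots (Q n))) \<le> c * (cmod (mu a - z0) / cmod (mu N - z0)) ^ (2 * n)"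
proof -
  define \<rho> where "\<rho> = cmod (mu N - z0)"
  have \<rho>: "0 < \<rho>" unfolding \<rho>_def using mu_neq by simp
  define R where "R b = nodal mu ({..<N} - {b})" for b
  define x where "x n b = cmod (poly (Q n) (mu b))" for n b
  have degQ: "degree (Q n) \<le> N" and normQ: "(\<Sum>j\<le>N. (cmod (shifted_coeff z0 (Q n) j))\<^sup>2) = 1" if "N \<le> n" for n
    using Q[OF that] unfolding normalized_polys_iff by auto
  have R_nz: "poly (R b) (mu b) \<noteq> 0" for b
    unfolding R_def using inj_mu by (auto simp: poly_nodal_eq_0_iff inj_eq)
  have x_lim: "(\<lambda>n. x n b) \<longlonglongrightarrow> 0" if b: "b < N" for b
  proof -
    obtain K where K: "\<And>n. n \<ge> N \<Longrightarrow> x n b \<le> K * (cmod (mu b - z0) / \<rho>) ^ (2 * n)"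
      using minimizer_at_pole[OF b Q minimal] unfolding x_def \<rho>_def by blast
    have "cmod (mu b - z0) < \<rho>"
      unfolding \<rho>_def using ordered[of b "N - 1"] gap b by linarith
    then have "(cmod (mu b - z0) / \<rho>)\<^sup>2 < 1"
      using \<rho> by (simp add: power_less_one_iff)
    then have "(\<lambda>n. K * ((cmod (mu b - z0) / \<rho>)\<^sup>2) ^ n) \<longlonglongrightarrow> K * 0"
      by (intro tendsto_mult tendsto_const LIMSEQ_power_zero) simp
    then have "(\<lambda>n. K * (cmod (mu b - z0) / \<rho>) ^ (2 * n)) \<longlonglongrightarrow> 0"
      by (simp add: power_mult)
    then show ?thesis
      by (rule Lim_null_comparison[rotated])
        (use K in \<open>auto simp: x_def eventually_sequentially intro!: exI[of _ N]\<close>)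
  qed
  have sum_lim: "(\<lambda>n. \<Sum>b<N. x n b * g b) \<longlonglongrightarrow> 0" for g :: "nat \<Rightarrow> real"
  proof -
    have "(\<lambda>n. \<Sum>b<N. x n b * g b) \<longlonglongrightarrow> (\<Sum>b<N. 0 * g b)"
      by (intro tendsto_sum tendsto_mult tendsto_const x_lim) simp
    then show ?thesis by simp
  qed
  have Lagrange: "Q n = smult (coeff (Q n) N) (nodal mu {..<N}) +
      (\<Sum>b<N. smult (poly (Q n) (mu b) / poly (R b) (mu b)) (R b))" if "N \<le> n" for n
    unfolding R_def by (intro Lagrange_interpolation inj_on_subset[OF inj_mu subset_UNIV] degQ that)
  define A where "A = (\<Sum>j\<le>N. cmod (shifted_coeff z0 (nodal mu {..<N}) j))"
  define g where "g b = (\<Sum>j\<le>N. cmod (shifted_coeff z0 (R b) j)) / cmod (poly (R b) (mu b))" for b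
  define g' where "g' b = cmod (poly (pderiv (R b)) (mu a)) / cmod (poly (R b) (mu b))" for b
  \<comment> \<open>Normalisation keeps the leading coefficient away from zero once the values at the poles
      are small.\<close>
  have lead: "1 \<le> cmod (coeff (Q n) N) * A + (\<Sum>b<N. x n b * g b)" if n: "N \<le> n" for n
  proof -
    have le1: "cmod (shifted_coeff z0 (Q n) j) \<le> 1" if "j \<le> N" for j
      using Q[OF n] that by (rule normalized_coeff_le_1)
    have "1 \<le> (\<Sum>j\<le>N. cmod (shifted_coeff z0 (Q n) j))"
      unfolding normQ[OF n, symmetric] power2_eq_square
      by (intro sum_mono) (auto intro!: mult_left_le_one_le le1)
    also have "\<dots> \<le> (\<Sum>j\<le>N. cmod (coeff (Q n) N) * cmod (shifted_coeff z0 (nodal mu {..<N}) j) +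
        (\<Sum>b<N. x n b * (cmod (shifted_coeff z0 (R b) j) / cmod (poly (R b) (mu b)))))"
    proof (rule sum_mono)
      fix j
      have "shifted_coeff z0 (Q n) j = coeff (Q n) N * shifted_coeff z0 (nodal mu {..<N}) j +
          (\<Sum>b<N. poly (Q n) (mu b) / poly (R b) (mu b) * shifted_coeff z0 (R b) j)"
        by (subst Lagrange[OF n]) (simp only: shifted_coeff_add shifted_coeff_sum shifted_coeff_smult)
      also have "cmod \<dots> \<le> cmod (coeff (Q n) N) * cmod (shifted_coeff z0 (nodal mu {..<N}) j) +
          (\<Sum>b<N. x n b * (cmod (shifted_coeff z0 (R b) j) / cmod (poly (R b) (mu b))))"
        by (rule order.trans[OF norm_triangle_ineq])
          (auto simp: norm_mult norm_divide x_def intro!: order.trans[OF norm_sum] sum_mono)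
      finally show "cmod (shifted_coeff z0 (Q n) j) \<le> cmod (coeff (Q n) N) * cmod (shifted_coeff z0 (nodal mu {..<N}) j) +
          (\<Sum>b<N. x n b * (cmod (shifted_coeff z0 (R b) j) / cmod (poly (R b) (mu b))))" .
    qed
    also have "\<dots> = cmod (coeff (Q n) N) * A + (\<Sum>b<N. x n b * g b)"
      unfolding sum.distrib A_def g_def sum_distrib_left sum_divide_distrib
      by (subst sum.swap) simp
    finally show ?thesis .
  qed
  have ev1: "\<forall>\<^sub>F n in sequentially. (\<Sum>b<N. x n b * g b) < 1 / 2"
    by (rule order_tendstoD(2)[OF sum_lim]) simp
  have A: "0 < A"
  proof -
    obtain n where "N \<le> n" "(\<Sum>b<N. x n b * g b) < 1 / 2"
      using eventually_happens[OF eventually_conj[OF eventually_ge_at_top[of N] ev1]] by auto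
    then have "A \<noteq> 0" using lead[of n] by auto
    then show ?thesis unfolding A_def by (simp add: order_less_le sum_nonneg)
  qed
  \<comment> \<open>The leading coefficient is eventually at least \<open>1 / (2 A)\<close>, so the main part of the derivative
      of \<open>Q n\<close> at \<open>mu a\<close> is at least \<open>2 m\<close>; half of that may be lost to the other terms.\<close>
  define m where "m = cmod (poly (R a) (mu a)) / (4 * A)"
  have m: "0 < m" unfolding m_def using A R_nz by simp
  have ev2: "\<forall>\<^sub>F n in sequentially. (\<Sum>b<N. x n b * g' b) < m"
    by (rule order_tendstoD(2)[OF sum_lim m])
  obtain K where K: "\<And>n. n \<ge> N \<Longrightarrow> x n a \<le> K * (cmod (mu a - z0) / \<rho>) ^ (2 * n)"
    using minimizer_at_pole[OF N Q minimal] unfolding x_def \<rho>_def by blast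
  have "\<forall>\<^sub>F n in sequentially. size (proots (Q n)) = N \<and>
    Min ((\<lambda>r. cmod (r - mu a)) ` set_mset (proots (Q n))) \<le> N * K / m * (cmod (mu a - z0) / \<rho>) ^ (2 * n)"
    using eventually_ge_at_top[of N] ev1 ev2
  proof eventually_elim
    case (elim n)
    define c where "c = coeff (Q n) N"
    have c: "1 / 2 < cmod c * A"
      unfolding c_def using lead[OF elim(1)] elim(2) by linarith
    then have "c \<noteq> 0" by auto
    then have deg: "degree (Q n) = N"
      unfolding c_def using degQ[OF elim(1)] le_degree[of "Q n" N] by simp
    define Z where "Z = (\<Sum>b<N. poly (Q n) (mu b) / poly (R b) (mu b) * poly (pderiv (R b)) (mu a))"
    have "poly (pderiv (Q n)) (mu a) = c * poly (R a) (mu a) + Z"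
      unfolding c_def Z_def using N
      by (subst Lagrange[OF elim(1)])
        (simp add: pderiv_add pderiv_smult higher_pderiv_sum[of 1, simplified] poly_sum poly_pderiv_nodal flip: R_def)
    then have "cmod (c * poly (R a) (mu a)) \<le> cmod (poly (pderiv (Q n)) (mu a)) + cmod Z"
      using norm_triangle_ineq4[of "c * poly (R a) (mu a) + Z" Z] by simp
    also have "cmod Z \<le> (\<Sum>b<N. x n b * g' b)"
      unfolding Z_def by (rule order.trans[OF norm_sum]) (simp add: norm_mult norm_divide x_def g'_def)
    finally have "cmod c * cmod (poly (R a) (mu a)) < cmod (poly (pderiv (Q n)) (mu a)) + m"
      using elim(3) by (simp add: norm_mult)
    moreover have "2 * m \<le> cmod c * cmod (poly (R a) (mu a))"
    proof -
      have "1 / 2 * cmod (poly (R a) (mu a)) \<le> cmod c * A * cmod (poly (R a) (mu a))"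
        using c by (intro mult_right_mono) auto
      then show ?thesis
        unfolding m_def using A by (simp add: field_simps)
    qed
    ultimately have pd: "m \<le> cmod (poly (pderiv (Q n)) (mu a))"
      by linarith
    have "Q n \<noteq> 0" using \<open>c \<noteq> 0\<close> unfolding c_def by auto
    then have roots: "set_mset (proots (Q n)) = {r. poly (Q n) r = 0}"
      by simp
    have sz: "size (proots (Q n)) = N"
      using size_proots_complex[of "Q n"] deg by simp
    define M where "M = Min ((\<lambda>r. cmod (r - mu a)) ` set_mset (proots (Q n)))"
    have ne: "set_mset (proots (Q n)) \<noteq> {}"
      using sz N by auto
    have "M \<le> cmod (mu a - r)" if "poly (Q n) r = 0" for r
      unfolding M_def using that \<open>Q n \<noteq> 0\<close> by (intro Min_le) (auto simp: norm_minus_commute poly_roots_finite)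
    moreover have "0 \<le> M"
      unfolding M_def using ne by (intro Min.boundedI) auto
    ultimately have "M * cmod (poly (pderiv (Q n)) (mu a)) \<le> N * x n a"
      using root_distance[of M "Q n" "mu a"] deg unfolding x_def by simp
    then have "M * m \<le> N * x n a"
      using mult_left_mono[OF pd \<open>0 \<le> M\<close>] by linarith
    also have "\<dots> \<le> N * (K * (cmod (mu a - z0) / \<rho>) ^ (2 * n))"
      by (intro mult_left_mono K elim) auto
    finally have "M \<le> N * K / m * (cmod (mu a - z0) / \<rho>) ^ (2 * n)"
      using m by (simp add: pos_le_divide_eq[symmetric] mult_ac)
    then show ?case
      using sz unfolding M_def by simp
  qed
  then show ?thesis
    unfolding \<rho>_def by blast
qed

end

section \<open>Convergence rate of the poles of the fast Pade denominators\<close>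

theorem theorem5p5:
  fixes D :: "'v::complex_hilbert_space set"
    and L :: "'v \<Rightarrow> 'v"
    and vstar :: 'v
    and z0 :: complex
    and lam :: "nat \<Rightarrow> complex"
    and N :: nat
    and Q :: "nat \<Rightarrow> complex poly"
  assumes separable: "separable_space (euclidean :: 'v topology)"
    and linear: "linear_operator D L"
    and dense: "closure D = UNIV"
    and bijective: "bij_betw L D UNIV"
    and inverse_compact: "compact_operator (inv_into D L)"
    and inverse_normal: "normal_operator (inv_into D L)"
    and z0: "z0 \<notin> spectrum D L"
    and infinite_spectrum: "infinite (spectrum D L)"
    and projections: "\<forall>l \<in> spectrum D L. orth_proj (eigenspace D L l) vstar \<noteq> 0"
    and enumeration: "bij_betw lam {1..} (spectrum D L)"
    and ordered: "\<forall>\<alpha>\<ge>1. cmod (lam \<alpha> - z0) \<le> cmod (lam (\<alpha> + 1) - z0)"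
    and N: "N \<noteq> 0"
    and gap: "cmod (lam N - z0) < cmod (lam (N + 1) - z0)"
    and denominator: "\<forall>E\<ge>N. is_fast_pade_denominator (solution D L vstar) z0 N E (Q E)"
  shows "\<forall>\<alpha>\<in>{1..N}. \<exists>c::real. \<forall>\<^sub>F E in sequentially.
           size (proots (Q E)) = N \<and>
           Min ((\<lambda>r. cmod (r - lam \<alpha>)) ` set_mset (proots (Q E)))
             \<le> c * cmod ((lam \<alpha> - z0) / (lam (N + 1) - z0)) ^ (2 * E)"
proof
  fix \<alpha> assume \<alpha>: "\<alpha> \<in> {1..N}"
  interpret op: compact_normal_inverse D L
    by unfold_locales (fact linear bijective inverse_compact inverse_normal)+
  define mu where "mu k = lam (Suc k)" for k
  define v where "v k = orth_proj (eigenspace D L (mu k)) vstar" for k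
  \<comment> \<open>The poles are enumerated from 1 in the statement and from 0 in the lemmas.\<close>
  have "bij_betw Suc UNIV {1..}"
    by (intro bij_betwI[where g = "\<lambda>n. n - 1"]) auto
  from bij_betw_trans[OF this enumeration] have bij: "bij_betw mu UNIV (spectrum D L)"
    unfolding mu_def o_def .
  then have mu: "inj mu" "range mu = spectrum D L"
    by (simp_all add: bij_betw_def)
  have mu_spec: "mu k \<in> spectrum D L" for k
    using mu(2) by (metis rangeI)
  have series: "square_summable_orthogonal_series v"
    unfolding v_def using mu by (rule op.eigenprojections(1))
  interpret pole_expansion v mu z0
  proof (intro pole_expansion.intro series pole_expansion_axioms.intro)
    show "v k \<noteq> 0" for k
      unfolding v_def using projections mu_spec by blast
    show "mu k \<noteq> z0" for k
      using z0 mu_spec[of k] by auto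
    show "cmod (mu j - z0) \<le> cmod (mu k - z0)" if "j \<le> k" for j k
      by (rule lift_Suc_mono_le[of "\<lambda>k. cmod (mu k - z0)", OF _ that]) (use ordered in \<open>simp add: mu_def\<close>)
  qed (rule mu(1))
  define r where "r = cmod (mu 0 - z0) / 2"
  have r: "0 < r" unfolding r_def using z0 mu_spec[of 0] by auto
  have S: "solution D L vstar z = (\<Sum>k. (1 / (mu k - z)) *\<^sub>C v k)" if "z \<in> ball z0 r" for z
    unfolding v_def
  proof (rule op.solution_eq_series[OF mu r])
    fix k
    have "2 * r \<le> cmod (mu k - z0)"
      using ordered[of 0 k] unfolding r_def by simp
    also have "\<dots> \<le> cmod (mu k - z) + cmod (z - z0)"
      using norm_triangle_ineq[of "mu k - z" "z - z0"] by simp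
    finally show "r \<le> cmod (mu k - z)"
      using that by (simp add: dist_norm norm_minus_commute)
  qed
  have functional: "pade_functional (solution D L vstar) z0 n P = norm (tau n P)"
    if "degree P \<le> n" for n P
    unfolding pade_functional_def using taylor_coeff_eq_tau[OF that] S unfolding r_def by simp
  have Q: "Q n \<in> normalized_polys N z0" if "N \<le> n" for n
    using denominator that unfolding is_fast_pade_denominator_def is_arg_min_def by blast
  have minimal: "norm (tau n (Q n)) \<le> norm (tau n P)" if n: "N \<le> n" and P: "P \<in> normalized_polys N z0" for n P
  proof -
    have "\<not> pade_functional (solution D L vstar) z0 n P < pade_functional (solution D L vstar) z0 n (Q n)"
      using denominator n P unfolding is_fast_pade_denominator_def is_arg_min_def by blast
    moreover have "degree P \<le> n" "degree (Q n) \<le> n"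
      using P Q[OF n] n unfolding normalized_polys_iff by auto
    ultimately show ?thesis
      by (simp add: functional)
  qed
  obtain a where a: "\<alpha> = Suc a" "a < N"
    using \<alpha> by (cases \<alpha>) auto
  have "cmod (mu (N - 1) - z0) < cmod (mu N - z0)"
    using gap N unfolding mu_def by simp
  from minimizer_roots[OF a(2) this Q minimal]
  show "\<exists>c::real. \<forall>\<^sub>F E in sequentially.
      size (proots (Q E)) = N \<and>
      Min ((\<lambda>r. cmod (r - lam \<alpha>)) ` set_mset (proots (Q E)))
        \<le> c * cmod ((lam \<alpha> - z0) / (lam (N + 1) - z0)) ^ (2 * E)"
    unfolding mu_def a(1) norm_divide by simp
qed

end
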